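(* Let $H$ be a complex Hilbert space, let $T$ be a closed (possibly unbounded) linear operator in $H$ with domain $D(T)\subset H$, and let $N$ be a (possibly unbounded) normal operator in $H$ with domain $D(N)$. If $D(N)\subset D(T)$ and $TN\subset NT$, then $TN^*\subset N^*T$.
   Context: A densely defined closed operator $N$ is normal if $NN^*=N^*N$ (including equality of domains). For linear operators $S,R$, the product $SR$ is defined on $D(SR)=\{x\in D(R): Rx\in D(S)\}$ by $(SR)x=S(Rx)$. For operators $S_1,S_2$, $S_1\subset S_2$ means $D(S_1)\subset D(S_2)$ and $S_2x=S_1x$ for all $x\in D(S_1)$. *)

theory Defs
  imports "HOL-Analysis.Analysis"
begin

class complex_hilbert = banach +
  fixes scaleC :: "complex \<Rightarrow> 'a \<Rightarrow> 'a"  (infixr \<open>*\<^sub>C\<close> 75)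
    and cinner :: "'a \<Rightarrow> 'a \<Rightarrow> complex"
  assumes scaleC_add_right: "a *\<^sub>C (x + y) = a *\<^sub>C x + a *\<^sub>C y"
    and scaleC_add_left: "(a + b) *\<^sub>C x = a *\<^sub>C x + b *\<^sub>C x"
    and scaleC_scaleC: "a *\<^sub>C (b *\<^sub>C x) = (a * b) *\<^sub>C x"
    and scaleC_one: "1 *\<^sub>C x = x"
    and scaleR_scaleC: "scaleR r x = complex_of_real r *\<^sub>C x"
    and cinner_add_left: "cinner (x + y) z = cinner x z + cinner y z"
    and cinner_scaleC_left: "cinner (a *\<^sub>C x) y = cnj a * cinner x y"
    and cinner_commute: "cinner y x = cnj (cinner x y)"
    and cinner_self_norm: "cinner x x = complex_of_real ((norm x)\<^sup>2)"

type_synonym 'a op = "'a set \<times> ('a \<Rightarrow> 'a)"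

definition dom :: "'a op \<Rightarrow> 'a set" where "dom T = fst T"
definition app :: "'a op \<Rightarrow> 'a \<Rightarrow> 'a" where "app T = snd T"

definition linear_op :: "'a::complex_hilbert op \<Rightarrow> bool" where
  "linear_op T \<longleftrightarrow>
     0 \<in> dom T \<and>
     (\<forall>x\<in>dom T. \<forall>y\<in>dom T. x + y \<in> dom T \<and> app T (x + y) = app T x + app T y) \<and>
     (\<forall>c. \<forall>x\<in>dom T. c *\<^sub>C x \<in> dom T \<and> app T (c *\<^sub>C x) = c *\<^sub>C app T x)"

definition graph :: "'a op \<Rightarrow> ('a \<times> 'a) set" where
  "graph T = {(x, app T x) | x. x \<in> dom T}"

definition closed_op :: "'a::complex_hilbert op \<Rightarrow> bool" where
  "closed_op T \<longleftrightarrow> linear_op T \<and> closed (graph T)"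

definition densely_defined :: "'a::complex_hilbert op \<Rightarrow> bool" where
  "densely_defined T \<longleftrightarrow> closure (dom T) = UNIV"

definition adjoint :: "'a::complex_hilbert op \<Rightarrow> 'a op" where
  "adjoint T =
    ({y. \<exists>z. \<forall>x\<in>dom T. cinner (app T x) y = cinner x z},
     \<lambda>y. THE z. \<forall>x\<in>dom T. cinner (app T x) y = cinner x z)"

definition op_comp :: "'a op \<Rightarrow> 'a op \<Rightarrow> 'a op" where
  "op_comp S R = ({x \<in> dom R. app R x \<in> dom S}, \<lambda>x. app S (app R x))"

definition op_le :: "'a op \<Rightarrow> 'a op \<Rightarrow> bool" where
  "op_le S1 S2 \<longleftrightarrow> dom S1 \<subseteq> dom S2 \<and> (\<forall>x\<in>dom S1. app S2 x = app S1 x)"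

definition op_eq :: "'a op \<Rightarrow> 'a op \<Rightarrow> bool" where
  "op_eq S1 S2 \<longleftrightarrow> dom S1 = dom S2 \<and> (\<forall>x\<in>dom S1. app S1 x = app S2 x)"

definition normal_op :: "'a::complex_hilbert op \<Rightarrow> bool" where
  "normal_op N \<longleftrightarrow> densely_defined N \<and> closed_op N \<and>
     op_eq (op_comp N (adjoint N)) (op_comp (adjoint N) N)"

end

theory Submission
  imports Defs "HOL-Complex_Analysis.Complex_Analysis"
begin

text \<open>
  The resolvent \<open>B = (1 + N* N)\<^sup>-\<^sup>1\<close> is a self-adjoint contraction commuting with \<open>N\<close> and \<open>N*\<close>.
  If \<open>K = ker (\<bar>B - c\<bar> - (B - c))\<close>, then \<open>B \<ge> c\<close> on \<open>K\<close>, so that \<open>K\<close> reduces \<open>N\<close> to a bounded normal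
  operator, and \<open>B \<le> c\<close> on the orthogonal complement of \<open>K\<close>, so that the projection onto \<open>K\<close> tends
  strongly to the identity as \<open>c\<close> tends to \<open>0\<close>.  This replaces the spectral theorem.

  By the closed graph theorem \<open>T\<close> is bounded relative to \<open>N\<close>, so \<open>\<phi> v w = \<langle>T v, w\<rangle>\<close> is a bounded form on
  \<open>K \<times> L\<close> for two such subspaces, with \<open>\<phi> (N v) w = \<phi> v (N* w)\<close>.  Rosenblum's argument gives
  \<open>\<phi> (N* v) w = \<phi> v (N w)\<close>.  It is applied to the polynomials
  \<open>\<phi> ((1 - cnj \<zeta> N* / k)\<^sup>k v) ((1 + \<zeta> N / k)\<^sup>k w)\<close> in \<open>\<zeta>\<close> instead of exponentials: all of them have derivative
  \<open>\<phi> v (N w) - \<phi> (N* v) w\<close> at \<open>0\<close>, and as \<open>k\<close> tends to infinity they are bounded on every disc by a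
  constant independent of its radius, so Cauchy's inequality applies.

  Finally let \<open>y = N* x\<close> lie in the domain of \<open>T\<close>.  The domain of \<open>N\<close> need not be a core of \<open>T\<close>, so \<open>T y\<close> is
  not directly a limit of \<open>T\<close> on the cut-offs of \<open>y\<close>.  But \<open>y = B y + N z\<close> with \<open>z = N* B y\<close>, where \<open>B y\<close> and
  \<open>z\<close> lie in the domain of \<open>N\<close>, and \<open>T N z = N T z\<close>.
\<close>

section \<open>Hilbert space geometry\<close>

lemma cinner_add_right: "cinner x (y + z) = cinner x y + cinner x (z::'a::complex_hilbert)"
  by (metis cinner_add_left cinner_commute complex_cnj_add)

lemma cinner_scaleC_right: "cinner x (a *\<^sub>C y) = a * cinner x (y::'a::complex_hilbert)"
  by (metis cinner_commute cinner_scaleC_left complex_cnj_cnj complex_cnj_mult)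

lemma cinner_zero_left [simp]: "cinner 0 (y::'a::complex_hilbert) = 0"
  using cinner_add_left[of 0 0 y] by simp

lemma cinner_zero_right [simp]: "cinner (x::'a::complex_hilbert) 0 = 0"
  using cinner_add_right[of x 0 0] by simp

lemma cinner_minus_left: "cinner (- x) y = - cinner x (y::'a::complex_hilbert)"
  using cinner_add_left[of x "- x" y] by (simp add: add_eq_0_iff)

lemma cinner_minus_right: "cinner x (- y) = - cinner x (y::'a::complex_hilbert)"
  using cinner_add_right[of x y "- y"] by (simp add: add_eq_0_iff)

lemma cinner_diff_left: "cinner (x - z) y = cinner x y - cinner z (y::'a::complex_hilbert)"
  using cinner_add_left[of x "- z" y] by (simp add: cinner_minus_left)

lemma cinner_diff_right: "cinner x (y - z) = cinner x y - cinner x (z::'a::complex_hilbert)"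
  using cinner_add_right[of x y "- z"] by (simp add: cinner_minus_right)

lemma cinner_scaleR_left: "cinner (r *\<^sub>R x) y = of_real r * cinner x (y::'a::complex_hilbert)"
  by (simp add: scaleR_scaleC cinner_scaleC_left)

lemma cinner_scaleR_right: "cinner x (r *\<^sub>R y) = of_real r * cinner x (y::'a::complex_hilbert)"
  by (simp add: scaleR_scaleC cinner_scaleC_right)

lemmas cinner_simps = cinner_add_left cinner_add_right cinner_diff_left cinner_diff_right
  cinner_minus_left cinner_minus_right cinner_scaleC_left cinner_scaleC_right
  cinner_scaleR_left cinner_scaleR_right

lemma scaleC_zero_left [simp]: "0 *\<^sub>C (x::'a::complex_hilbert) = 0"
  using scaleC_add_left[of 0 0 x] by simp

lemma scaleC_zero_right [simp]: "c *\<^sub>C (0::'a::complex_hilbert) = 0"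
  using scaleC_add_right[of c 0 0] by simp

lemma scaleC_minus_left: "(- c) *\<^sub>C (x::'a::complex_hilbert) = - (c *\<^sub>C x)"
  using scaleC_add_left[of c "- c" x] by (simp add: add_eq_0_iff)

lemma scaleC_minus_right: "c *\<^sub>C (- x::'a::complex_hilbert) = - (c *\<^sub>C x)"
  using scaleC_add_right[of c x "- x"] by (simp add: add_eq_0_iff)

lemma scaleC_minus_one: "(- 1) *\<^sub>C x = - (x::'a::complex_hilbert)"
  by (simp add: scaleC_minus_left scaleC_one)

lemma scaleC_diff_right: "c *\<^sub>C (x - y::'a::complex_hilbert) = c *\<^sub>C x - c *\<^sub>C y"
  using scaleC_add_right[of c x "- y"] by (simp add: scaleC_minus_right)

lemma power2_norm_eq_cinner: "(norm (x::'a::complex_hilbert))\<^sup>2 = Re (cinner x x)"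
  by (simp add: cinner_self_norm)

lemma norm_scaleC: "norm (c *\<^sub>C (x::'a::complex_hilbert)) = cmod c * norm x"
proof -
  have "(norm (c *\<^sub>C x))\<^sup>2 = Re (cnj c * c * cinner x x)"
    by (simp only: power2_norm_eq_cinner cinner_scaleC_left cinner_scaleC_right mult_ac)
  also have "cnj c * c = of_real ((cmod c)\<^sup>2)"
    using complex_norm_square[of c] by (simp add: mult.commute)
  also have "Re (of_real ((cmod c)\<^sup>2) * cinner x x) = (cmod c * norm x)\<^sup>2"
    by (simp add: cinner_self_norm power_mult_distrib flip: of_real_mult of_real_power)
  finally show ?thesis by (simp add: power2_eq_iff_nonneg)
qed

lemma Re_cinner_commute: "Re (cinner x y) = Re (cinner y (x::'a::complex_hilbert))"
  by (metis cinner_commute complex_cnj(1) complex.sel(1) complex_surj)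

lemma norm_add_sq: "(norm (x + y))\<^sup>2 = (norm x)\<^sup>2 + 2 * Re (cinner x y) + (norm (y::'a::complex_hilbert))\<^sup>2"
  by (simp add: power2_norm_eq_cinner cinner_simps Re_cinner_commute[of y x])

lemma norm_diff_sq: "(norm (x - y))\<^sup>2 = (norm x)\<^sup>2 - 2 * Re (cinner x y) + (norm (y::'a::complex_hilbert))\<^sup>2"
  by (simp add: power2_norm_eq_cinner cinner_simps Re_cinner_commute[of y x])

text \<open>Cauchy-Schwarz for real parts, from a nonnegative square in which the two vectors are
  scaled to equal norm.\<close>

lemma Re_cinner_le: "Re (cinner x y) \<le> norm x * norm (y::'a::complex_hilbert)"
proof (cases "x = 0 \<or> y = 0")
  case False
  have "0 \<le> (norm (norm y *\<^sub>R x - norm x *\<^sub>R y))\<^sup>2" by simp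
  also have "\<dots> = 2 * (norm x * norm y) * (norm x * norm y - Re (cinner x y))"
    unfolding norm_diff_sq by (simp add: cinner_simps power2_eq_square algebra_simps)
  finally show ?thesis using False by (auto simp: zero_le_mult_iff mult_le_0_iff not_le)
qed auto

lemma norm_cinner_le: "norm (cinner x y) \<le> norm x * norm (y::'a::complex_hilbert)"
proof (cases "cinner x y = 0")
  case False
  \<comment> \<open>The phase \<open>c\<close> turns the inner product into its modulus, so the
    inequality for real parts suffices.\<close>
  define c where "c = cnj (cinner x y) / norm (cinner x y)"
  have c: "cmod c = 1" using False by (simp add: c_def norm_divide)
  have "cinner x (c *\<^sub>C y) = norm (cinner x y)"
    using complex_norm_square[of "cinner x y"]  False
    by (simp add: cinner_scaleC_right c_def power2_eq_square field_simps)
  then have "norm (cinner x y) = Re (cinner x (c *\<^sub>C y))" by simp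
  also have "\<dots> \<le> norm x * norm y"
    using Re_cinner_le[of x "c *\<^sub>C y"] c by (simp add: norm_scaleC)
  finally show ?thesis .
qed auto

lemma bounded_bilinear_cinner: "bounded_bilinear (cinner :: 'a::complex_hilbert \<Rightarrow> 'a \<Rightarrow> complex)"
  by (unfold_locales) (auto simp: cinner_simps scaleR_conv_of_real intro!: exI[of _ 1] norm_cinner_le)

lemmas tendsto_cinner = bounded_bilinear.tendsto[OF bounded_bilinear_cinner]

lemma bounded_linear_scaleC: "bounded_linear (\<lambda>x::'a::complex_hilbert. c *\<^sub>C x)"
  by (rule bounded_linear_intro[of _ "cmod c"])
    (auto simp: scaleC_add_right norm_scaleC scaleR_scaleC scaleC_scaleC mult.commute)

text \<open>Turns estimates of a squared norm by an inner product into contraction bounds.\<close>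

lemma norm_le_of_sq_le_mult:
  fixes a b :: real
  assumes "a\<^sup>2 \<le> a * b" "0 \<le> b"
  shows "a \<le> b"
  using assms by (cases "a > 0") (auto simp: power2_eq_square)

lemma cinner_eq_zero_imp: "(\<And>y. cinner (x::'a::complex_hilbert) y = 0) \<Longrightarrow> x = 0"
  by (metis cinner_self_norm norm_eq_zero of_real_eq_0_iff power_eq_0_iff)

text \<open>The product is the orthogonal sum, in which operator graphs are closed subspaces.\<close>

instantiation prod :: (complex_hilbert, complex_hilbert) complex_hilbert
begin
definition "scaleC_prod c p = (c *\<^sub>C fst p, c *\<^sub>C snd p)"
definition "cinner_prod p q = cinner (fst p) (fst q) + cinner (snd p) (snd q)"
instance
proof
  fix a b :: complex and x y z :: "'a \<times> 'b" and r :: real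
  show "a *\<^sub>C (x + y) = a *\<^sub>C x + a *\<^sub>C y"
    by (simp add: scaleC_prod_def scaleC_add_right)
  show "(a + b) *\<^sub>C x = a *\<^sub>C x + b *\<^sub>C x"
    by (simp add: scaleC_prod_def scaleC_add_left)
  show "a *\<^sub>C (b *\<^sub>C x) = (a * b) *\<^sub>C x"
    by (simp add: scaleC_prod_def scaleC_scaleC)
  show "1 *\<^sub>C x = x"
    by (simp add: scaleC_prod_def scaleC_one)
  show "scaleR r x = complex_of_real r *\<^sub>C x"
    by (simp add: scaleC_prod_def scaleR_prod_def scaleR_scaleC)
  show "cinner (x + y) z = cinner x z + cinner y z"
    by (simp add: cinner_prod_def cinner_add_left)
  show "cinner (a *\<^sub>C x) y = cnj a * cinner x y"
    by (simp add: cinner_prod_def scaleC_prod_def cinner_scaleC_left distrib_left)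
  show "cinner y x = cnj (cinner x y)"
    using cinner_commute[of "fst y" "fst x"] cinner_commute[of "snd y" "snd x"]
    by (simp add: cinner_prod_def)
  show "cinner x x = complex_of_real ((norm x)\<^sup>2)"
    by (simp add: cinner_prod_def cinner_self_norm norm_prod_def)
qed
end

section \<open>Closed complex subspaces and orthogonal projections\<close>

definition csubspace :: "'a::complex_hilbert set \<Rightarrow> bool" where
  "csubspace S \<longleftrightarrow> 0 \<in> S \<and> (\<forall>x\<in>S. \<forall>y\<in>S. x + y \<in> S) \<and> (\<forall>c. \<forall>x\<in>S. c *\<^sub>C x \<in> S)"

lemma csubspace_diff: "csubspace S \<Longrightarrow> x \<in> S \<Longrightarrow> y \<in> S \<Longrightarrow> x - y \<in> S"
  unfolding csubspace_def by (metis diff_conv_add_uminus scaleC_minus_one)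

lemma csubspace_scaleR: "csubspace S \<Longrightarrow> x \<in> S \<Longrightarrow> r *\<^sub>R x \<in> S"
  unfolding csubspace_def by (simp add: scaleR_scaleC)

text \<open>A minimising sequence for the distance from \<open>x\<close> to \<open>S\<close> is
  Cauchy by the parallelogram law, because midpoints stay in \<open>S\<close>. Varying the limit
  within \<open>S\<close> yields orthogonality.\<close>

theorem orthogonal_projection_exists:
  fixes S :: "'a::complex_hilbert set"
  assumes S: "csubspace S" and cl: "closed S"
  obtains p where "p \<in> S" "\<And>s. s \<in> S \<Longrightarrow> cinner (x - p) s = 0"
proof -
  define d where "d = (INF s\<in>S. (norm (x - s))\<^sup>2)"
  have ne: "S \<noteq> {}" using S by (auto simp: csubspace_def)
  have bdd: "bdd_below ((\<lambda>s. (norm (x - s))\<^sup>2) ` S)" by (rule bdd_belowI[of _ 0]) auto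
  have d_le: "d \<le> (norm (x - s))\<^sup>2" if "s \<in> S" for s
    unfolding d_def using bdd that by (rule cINF_lower)
  have "\<exists>s\<in>S. (norm (x - s))\<^sup>2 < d + 1 / Suc n" for n
    using cINF_less_iff[OF ne bdd, of "d + 1 / Suc n"] unfolding d_def[symmetric] by simp
  then obtain s where s: "\<And>n. s n \<in> S" "\<And>n. (norm (x - s n))\<^sup>2 < d + 1 / Suc n"
    by metis
  have para: "(norm (s m - s n))\<^sup>2 \<le> 2 / Suc m + 2 / Suc n" for m n
  proof -
    have mid: "(1/2) *\<^sub>R (s m + s n) \<in> S"
      using S s(1) by (intro csubspace_scaleR) (auto simp: csubspace_def)
    have "(norm ((x - s n) - (x - s m)))\<^sup>2 + (norm ((x - s n) + (x - s m)))\<^sup>2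
          = 2 * (norm (x - s n))\<^sup>2 + 2 * (norm (x - s m))\<^sup>2"
      using norm_diff_sq[of "x - s n" "x - s m"] norm_add_sq[of "x - s n" "x - s m"] by simp
    moreover have "(x - s n) + (x - s m) = 2 *\<^sub>R (x - (1/2) *\<^sub>R (s m + s n))"
      by (simp add: algebra_simps scaleR_2)
    ultimately have "(norm (s m - s n))\<^sup>2 = 2 * (norm (x - s n))\<^sup>2 + 2 * (norm (x - s m))\<^sup>2
        - 4 * (norm (x - (1/2) *\<^sub>R (s m + s n)))\<^sup>2"
      by (simp add: power_mult_distrib)
    then show ?thesis using d_le[OF mid] s(2)[of m] s(2)[of n] by simp
  qed
  have "Cauchy s"
  proof (rule metric_CauchyI)
    fix e :: real assume e: "e > 0"
    obtain j :: nat where "4 / e\<^sup>2 < j" using reals_Archimedean2 by blast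
    then obtain k :: nat where k: "4 / e\<^sup>2 < Suc k" by (metis less_SucI of_nat_less_iff lessI less_trans)
    have k': "4 / Suc k < e\<^sup>2" using k e by (simp add: field_simps)
    have "dist (s m) (s n) < e" if "m \<ge> k" "n \<ge> k" for m n
    proof -
      have "2 / Suc m \<le> 2 / Suc k" "2 / Suc n \<le> 2 / Suc k"
        using that by (auto intro!: divide_left_mono)
      then have "(norm (s m - s n))\<^sup>2 < e\<^sup>2" using para[of m n] k' by simp
      then show ?thesis using e by (simp add: dist_norm power2_less_imp_less)
    qed
    then show "\<exists>M. \<forall>m\<ge>M. \<forall>n\<ge>M. dist (s m) (s n) < e" by blast
  qed
  then obtain p where p: "s \<longlonglongrightarrow> p" using Cauchy_convergent convergent_def by blast
  have pS: "p \<in> S" using closed_sequentially[OF cl _ p] s(1) by blast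
  have "(\<lambda>n. (norm (x - s n))\<^sup>2) \<longlonglongrightarrow> (norm (x - p))\<^sup>2" by (intro tendsto_intros p)
  moreover have "(\<lambda>n. d + 1 / Suc n) \<longlonglongrightarrow> d + 0"
    by (intro tendsto_intros LIMSEQ_Suc[OF lim_1_over_n])
  ultimately have "(norm (x - p))\<^sup>2 \<le> d + 0"
    by (rule LIMSEQ_le) (use s(2) less_imp_le in blast)
  then have min: "(norm (x - p))\<^sup>2 \<le> (norm (x - s))\<^sup>2" if "s \<in> S" for s
    using d_le[OF that] by linarith
  have Re0: "Re (cinner (x - p) s) = 0" if sS: "s \<in> S" for s
  proof (cases "s = 0")
    case False
    \<comment> \<open>This \<open>t\<close> minimises the squared norm of
      \<open>(x - p) - t *\<^sub>R s\<close>. Since \<open>p\<close> is already optimal, the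
      decrease it brings must vanish.\<close>
    define t where "t = Re (cinner (x - p) s) / (norm s)\<^sup>2"
    have "p + t *\<^sub>R s \<in> S"
      using S pS csubspace_scaleR[OF S sS, of t] unfolding csubspace_def by blast
    then have "(norm (x - p))\<^sup>2 \<le> (norm ((x - p) - t *\<^sub>R s))\<^sup>2"
      using min by (simp add: diff_diff_eq)
    also have "\<dots> = (norm (x - p))\<^sup>2 - 2 * t * Re (cinner (x - p) s) + t\<^sup>2 * (norm s)\<^sup>2"
      by (simp only: norm_diff_sq) (simp add: cinner_scaleR_right power_mult_distrib)
    also have "t\<^sup>2 * (norm s)\<^sup>2 = t * Re (cinner (x - p) s)"
      using False by (simp add: t_def power2_eq_square)
    finally have "(Re (cinner (x - p) s))\<^sup>2 / (norm s)\<^sup>2 \<le> 0"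
      by (simp add: t_def power2_eq_square)
    then show ?thesis using False by (simp add: divide_le_0_iff)
  qed auto
  have "cinner (x - p) s = 0" if sS: "s \<in> S" for s
  proof (rule complex_eqI)
    \<comment> \<open>By linearity in the second argument, the imaginary part against
      \<open>s\<close> is, up to sign, the real part against
      \<open>\<i> *\<^sub>C s\<close>.\<close>
    have "\<i> *\<^sub>C s \<in> S" using S sS by (auto simp: csubspace_def)
    from Re0[OF this] show "Im (cinner (x - p) s) = Im 0" by (simp add: cinner_scaleC_right)
  qed (use Re0[OF sS] in simp)
  with pS that show ?thesis by blast
qed

definition proj :: "'a::complex_hilbert set \<Rightarrow> 'a \<Rightarrow> 'a" where
  "proj S x = (SOME p. p \<in> S \<and> (\<forall>s\<in>S. cinner (x - p) s = 0))"

lemma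
  assumes "csubspace S" "closed S"
  shows proj_in: "proj S x \<in> S"
    and proj_ortho: "s \<in> S \<Longrightarrow> cinner (x - proj S x) s = 0"
proof -
  have "\<exists>p. p \<in> S \<and> (\<forall>s\<in>S. cinner (x - p) s = 0)"
    by (rule orthogonal_projection_exists[OF assms, of x]) blast
  then have *: "proj S x \<in> S \<and> (\<forall>s\<in>S. cinner (x - proj S x) s = 0)"
    unfolding proj_def by (rule someI_ex)
  show "proj S x \<in> S" using * ..
  show "cinner (x - proj S x) s = 0" if "s \<in> S" using * that by blast
qed

lemma proj_unique:
  assumes S: "csubspace S" "closed S" and p: "p \<in> S" "\<And>s. s \<in> S \<Longrightarrow> cinner (x - p) s = 0"
  shows "proj S x = p"
proof -
  have m: "proj S x - p \<in> S" using csubspace_diff S p proj_in by blast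
  have "proj S x - p = (x - p) - (x - proj S x)" by simp
  then have "cinner (proj S x - p) (proj S x - p) = 0"
    using p(2)[OF m] proj_ortho[OF S m, of x] by (metis cinner_diff_left diff_self)
  then show ?thesis by (simp add: cinner_self_norm)
qed

lemma
  assumes S: "csubspace S" "closed S"
  shows proj_add: "proj S (x + y) = proj S x + proj S y"
    and proj_diff: "proj S (x - y) = proj S x - proj S y"
    and proj_scaleC: "proj S (c *\<^sub>C x) = c *\<^sub>C proj S x"
    and proj_id: "k \<in> S \<Longrightarrow> proj S k = k"
proof -
  have mem: "proj S x + proj S y \<in> S" "c *\<^sub>C proj S x \<in> S" "proj S x - proj S y \<in> S"
    using S proj_in[OF S] csubspace_diff[OF S(1)] by (auto simp: csubspace_def)
  have o: "cinner (proj S x) s = cinner x s" if "s \<in> S" for x s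
    using proj_ortho[OF S that, of x] by (simp add: cinner_diff_left)
  show "proj S (x + y) = proj S x + proj S y"
    by (rule proj_unique[OF S mem(1)]) (simp add: cinner_simps o)
  show "proj S (x - y) = proj S x - proj S y"
    by (rule proj_unique[OF S mem(3)]) (simp add: cinner_simps o)
  show "proj S (c *\<^sub>C x) = c *\<^sub>C proj S x"
    by (rule proj_unique[OF S mem(2)]) (simp add: cinner_simps o)
  show "k \<in> S \<Longrightarrow> proj S k = k"
    by (rule proj_unique[OF S]) auto
qed

lemma cinner_proj_left:
  assumes S: "csubspace S" "closed S"
  shows "cinner (proj S x) y = cinner x (proj S y)"
proof -
  have "cinner x (proj S y) = cinner (proj S x) (proj S y)" for x y
    using proj_ortho[OF S proj_in[OF S], of x y] by (simp add: cinner_diff_left)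
  then show ?thesis by (metis cinner_commute)
qed

lemma norm_proj_le:
  assumes S: "csubspace S" "closed S"
  shows "norm (proj S x) \<le> norm x"
proof (rule norm_le_of_sq_le_mult)
  have "(norm (proj S x))\<^sup>2 = Re (cinner (proj S x) x)"
    by (metis S cinner_proj_left power2_norm_eq_cinner proj_id proj_in)
  then show "(norm (proj S x))\<^sup>2 \<le> norm (proj S x) * norm x"
    using Re_cinner_le[of "proj S x" x] by simp
qed simp

lemma norm_diff_proj_le:
  assumes S: "csubspace S" "closed S"
  shows "norm (x - proj S x) \<le> norm x"
proof (rule norm_le_of_sq_le_mult)
  have "(norm (x - proj S x))\<^sup>2 = Re (cinner (x - proj S x) x)"
    using proj_ortho[OF S proj_in[OF S], of x x] 
    by (simp only: power2_norm_eq_cinner) (simp add: cinner_diff_right)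
  then show "(norm (x - proj S x))\<^sup>2 \<le> norm (x - proj S x) * norm x"
    using Re_cinner_le[of "x - proj S x" x] by simp
qed simp

text \<open>Since \<open>D\<close> and its adjoint \<open>E\<close> both preserve \<open>S\<close>,
  \<open>D\<close> also preserves the orthogonal complement, so \<open>D (proj S x)\<close> has the
  two properties that characterise the projection of \<open>D x\<close>.\<close>

lemma proj_commute:
  assumes S: "csubspace S" "closed S"
    and lin: "\<And>x y. D (x - y) = D x - D y"
    and adj: "\<And>x y. cinner (D x) y = cinner x (E y)"
    and D: "\<And>x. x \<in> S \<Longrightarrow> D x \<in> S" and E: "\<And>x. x \<in> S \<Longrightarrow> E x \<in> S"
  shows "proj S (D x) = D (proj S x)"
proof (rule proj_unique[OF S])
  show "D (proj S x) \<in> S" using D proj_in[OF S] by blast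
  show "cinner (D x - D (proj S x)) s = 0" if "s \<in> S" for s
    using proj_ortho[OF S E[OF that], of x] by (simp add: adj flip: lin)
qed

section \<open>The closed graph theorem and linear operators\<close>

text \<open>Baire's theorem inside \<open>S\<close> bounds \<open>f\<close> on a dense part of a
  ball; successive approximation carries the bound to every point. The domain is a subspace because
  the theorem will be applied on the graph of an operator.\<close>

theorem closed_graph_theorem_on:
  fixes f :: "'a::banach \<Rightarrow> 'b::banach"
  assumes S: "subspace S" "closed S"
    and add: "\<And>x y. x \<in> S \<Longrightarrow> y \<in> S \<Longrightarrow> f (x + y) = f x + f y"
    and scale: "\<And>r x. x \<in> S \<Longrightarrow> f (r *\<^sub>R x) = r *\<^sub>R f x"
    and graph: "closed {(x, f x) | x. x \<in> S}"
  obtains C where "C \<ge> 0" "\<And>x. x \<in> S \<Longrightarrow> norm (f x) \<le> C * norm x"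
proof -
  define L where "L n = {x \<in> S. norm (f x) \<le> real n}" for n
  define A where "A n = closure (L n)" for n
  have AS: "A n \<subseteq> S" for n
    unfolding A_def L_def by (rule closure_minimal) (use S in auto)
  have un: "(\<Union>n. A n) = S"
  proof
    show "S \<subseteq> (\<Union>n. A n)"
    proof
      fix x assume "x \<in> S"
      moreover obtain n where "norm (f x) \<le> real n" using real_arch_simple by blast
      ultimately show "x \<in> (\<Union>n. A n)" using closure_subset by (force simp: A_def L_def)
    qed
  qed (use AS in blast)
  \<comment> \<open>\<open>S\<close> is complete and is the union of the relatively closed sets
    \<open>A n\<close>, so not all of them have empty interior in \<open>S\<close>.\<close>
  have "\<exists>n. top_of_set S interior_of (A n) \<noteq> {}"
  proof (rule ccontr)
    assume "\<not> ?thesis"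
    then have emp: "top_of_set S interior_of (A n) = {}" for n by blast
    have "completely_metrizable_space (top_of_set S)"
      by (rule completely_metrizable_space_closedin[OF completely_metrizable_space_euclidean
            S(2)[unfolded closed_closedin]])
    moreover have "closedin (top_of_set S) T \<and> top_of_set S interior_of T = {}" if "T \<in> range A" for T
      using that emp AS closedin_closed_eq[OF S(2)] unfolding A_def by auto
    ultimately have "top_of_set S interior_of \<Union>(range A) = {}"
      by (intro Baire_category_alt) auto
    moreover have "top_of_set S interior_of S = S"
      by (metis interior_of_topspace topspace_euclidean_subtopology)
    ultimately show False using un subspace_0[OF S(1)] by auto
  qed
  then obtain n x0 U where U: "openin (top_of_set S) U" "x0 \<in> U" "U \<subseteq> A n"
    unfolding interior_of_def by blast
  then obtain e where e: "e > 0" and ball: "ball x0 e \<inter> S \<subseteq> U"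
    unfolding openin_contains_ball by blast
  have x0: "x0 \<in> A n" "x0 \<in> S" using U AS by auto
  define M where "M = 2 * real n + 1"
  \<comment> \<open>Differences of points of \<open>L n\<close> near \<open>x0 + x\<close> and near
    \<open>x0\<close> move the ball to the origin, at the price of the bound
    \<open>2 * real n\<close>, which is below \<open>M\<close>.\<close>
  have near: "\<exists>a\<in>S. norm (x - a) < d \<and> norm (f a) \<le> M"
    if x: "x \<in> S" "norm x < e" and d: "d > 0" for x d
  proof -
    have "x0 + x \<in> ball x0 e \<inter> S"
      using x x0 subspace_add[OF S(1)] by (simp add: dist_norm)
    then have "x0 + x \<in> A n" using ball U(3) by blast
    with x0 obtain a b where a: "a \<in> L n" "dist a (x0 + x) < d/2" and b: "b \<in> L n" "dist b x0 < d/2"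
      using d unfolding A_def closure_approachable by (metis half_gt_zero)
    have abS: "a \<in> S" "b \<in> S" "(-1) *\<^sub>R b \<in> S"
      using a b subspace_scale[OF S(1)] by (auto simp: L_def subspace_neg[OF S(1)])
    have "norm (x - (a - b)) < d"
      using norm_triangle_ineq[of "(x0 + x) - a" "b - x0"] a(2) b(2)
      by (simp add: dist_norm norm_minus_commute algebra_simps)
    moreover have "f (a - b) = f a - f b"
      using add[OF abS(1,3)] scale[OF abS(2), of "-1"] by simp
    then have "norm (f (a - b)) \<le> M"
      using norm_triangle_ineq4[of "f a" "f b"] a(1) b(1) by (simp add: L_def M_def)
    ultimately show ?thesis using subspace_diff[OF S(1) abS(1,2)] by blast
  qed
  define C where "C = 2 * M / e"
  have C: "C \<ge> 0" using e by (simp add: C_def M_def)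
  have f0: "f 0 = 0" using scale[OF subspace_0[OF S(1)], of 0] by simp
  have approx: "\<exists>a\<in>S. norm (x - a) < d \<and> norm (f a) \<le> C * norm x" if x: "x \<in> S" and d: "d > 0" for x d
  proof (cases "x = 0")
    case True
    then show ?thesis using d f0 subspace_0[OF S(1)] by force
  next
    case False
    \<comment> \<open>Scaling \<open>x\<close> to norm \<open>e / 2\<close> brings it into the ball;
      scaling back multiplies \<open>M\<close> by \<open>2 * norm x / e\<close>, hence the constant
      \<open>C\<close>.\<close>
    define t where "t = e / (2 * norm x)"
    have t: "t > 0" using False e by (simp add: t_def)
    have "norm (t *\<^sub>R x) < e" using False e by (simp add: t_def)
    then obtain a where a: "a \<in> S" "norm (t *\<^sub>R x - a) < t * d" "norm (f a) \<le> M"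
      using near[of "t *\<^sub>R x" "t * d"] subspace_scale[OF S(1) x] t d by auto
    have "x - (1/t) *\<^sub>R a = (1/t) *\<^sub>R (t *\<^sub>R x - a)" using t by (simp add: algebra_simps)
    then have "norm (x - (1/t) *\<^sub>R a) = (1/t) * norm (t *\<^sub>R x - a)"
      using t by simp
    also have "\<dots> < d" using a(2) t by (simp add: field_simps)
    finally have "norm (x - (1/t) *\<^sub>R a) < d" .
    moreover have "norm (f ((1/t) *\<^sub>R a)) \<le> C * norm x"
      using a(3) t e False scale[OF a(1), of "1/t"]
      by (simp add: C_def t_def field_simps)
    ultimately show ?thesis using subspace_scale[OF S(1) a(1)] by blast
  qed
  then obtain \<alpha> where \<alpha>: "\<And>x d. x \<in> S \<Longrightarrow> d > 0 \<Longrightarrow>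
      \<alpha> x d \<in> S \<and> norm (x - \<alpha> x d) < d \<and> norm (f (\<alpha> x d)) \<le> C * norm x"
    by metis
  have "norm (f x) \<le> (2 * C) * norm x" if x: "x \<in> S" for x
  proof (cases "x = 0")
    case False
    \<comment> \<open>\<open>r k\<close> is the error left after \<open>k\<close> corrections. Its
      bound halves each time, so the values of \<open>f\<close> on the corrections are dominated by
      a geometric series with sum \<open>2 * C * norm x\<close>.\<close>
    define r where "r = rec_nat x (\<lambda>k y. y - \<alpha> y (norm x * (1/2) ^ Suc k))"
    have r_0: "r 0 = x" and r_Suc: "r (Suc k) = r k - \<alpha> (r k) (norm x * (1/2) ^ Suc k)" for k
      by (simp_all add: r_def)
    have pos: "norm x * (1/2) ^ k > 0" for k using False by simp
    have rS: "r k \<in> S" for k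
      by (induction k) (auto simp: r_0 r_Suc x simp del: power_Suc intro!: subspace_diff[OF S(1)] conjunct1[OF \<alpha>] pos)
    have rn: "norm (r k) \<le> norm x * (1/2) ^ k" for k
    proof (cases k)
      case (Suc j)
      then show ?thesis
        using \<alpha>[OF rS[of j] pos[of "Suc j"]] unfolding r_Suc Suc by (intro less_imp_le) blast
    qed (simp add: r_0)
    define a where "a k = \<alpha> (r k) (norm x * (1/2) ^ Suc k)" for k
    have aS: "a k \<in> S" for k
      using \<alpha>[OF rS[of k] pos[of "Suc k"]] unfolding a_def by blast
    have fa: "norm (f (a k)) \<le> C * norm x * (1/2) ^ k" for k
    proof -
      have "norm (f (a k)) \<le> C * norm (r k)" 
        using \<alpha>[OF rS[of k] pos[of "Suc k"]] unfolding a_def by blast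
      also have "\<dots> \<le> C * (norm x * (1/2) ^ k)" using rn C by (intro mult_left_mono)
      finally show ?thesis by (simp add: mult.assoc)
    qed
    have sums: "(\<lambda>k. C * norm x * (1/2) ^ k) sums (C * norm x * 2)"
      using sums_mult[OF geometric_sums[of "1/2::real"]] by simp
    have summ: "summable (\<lambda>k. f (a k))"
      by (rule summable_comparison_test'[OF sums_summable[OF sums]]) (use fa in auto)
    have part: "(\<Sum>i<k. a i) = x - r k" for k
      by (induction k) (auto simp: r_0 r_Suc a_def)
    have fpart: "(\<Sum>i<k. a i) \<in> S \<and> f (\<Sum>i<k. a i) = (\<Sum>i<k. f (a i))" for k
      by (induction k) (auto simp: f0 add aS subspace_0[OF S(1)] subspace_add[OF S(1)])
    have "(\<lambda>k. norm x * (1/2::real) ^ k) \<longlonglongrightarrow> norm x * 0"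
      by (intro tendsto_intros LIMSEQ_power_zero) auto
    then have "r \<longlonglongrightarrow> 0"
      by (intro Lim_null_comparison[of r]) (use rn in auto)
    then have "(\<lambda>k. \<Sum>i<k. a i) \<longlonglongrightarrow> x - 0"
      unfolding part by (intro tendsto_intros)
    moreover have "(\<lambda>k. \<Sum>i<k. f (a i)) \<longlonglongrightarrow> (\<Sum>k. f (a k))"
      using summ by (rule summable_LIMSEQ)
    \<comment> \<open>Partial sums and their images converge jointly, so the closed graph forces
      \<open>f x\<close> to be the sum of the images.\<close>
    ultimately have "(\<lambda>k. (\<Sum>i<k. a i, \<Sum>i<k. f (a i))) \<longlonglongrightarrow> (x, \<Sum>k. f (a k))"
      by (auto intro: tendsto_Pair)
    then have "(x, \<Sum>k. f (a k)) \<in> {(x, f x) | x. x \<in> S}"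
      by (rule closed_sequentially[OF graph, rotated]) (use fpart in \<open>auto intro!: exI\<close>)
    then have "f x = (\<Sum>k. f (a k))" by auto
    also have "norm \<dots> \<le> (\<Sum>k. C * norm x * (1/2) ^ k)"
      by (rule norm_suminf_le) (use fa sums_summable[OF sums] in auto)
    also have "\<dots> = C * norm x * 2" using sums by (rule sums_unique[symmetric])
    finally show ?thesis by (simp add: mult_ac)
  qed (simp add: f0)
  with C that[of "2 * C"] show ?thesis by auto
qed

section \<open>Closed operators and relative boundedness\<close>

lemma
  assumes "linear_op T"
  shows linear_op_0: "0 \<in> dom T" "app T 0 = 0"
    and linear_op_add: "x \<in> dom T \<Longrightarrow> y \<in> dom T \<Longrightarrow> x + y \<in> dom T"
      "x \<in> dom T \<Longrightarrow> y \<in> dom T \<Longrightarrow> app T (x + y) = app T x + app T y"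
    and linear_op_scaleC: "x \<in> dom T \<Longrightarrow> c *\<^sub>C x \<in> dom T"
      "x \<in> dom T \<Longrightarrow> app T (c *\<^sub>C x) = c *\<^sub>C app T x"
    and linear_op_diff: "x \<in> dom T \<Longrightarrow> y \<in> dom T \<Longrightarrow> x - y \<in> dom T"
      "x \<in> dom T \<Longrightarrow> y \<in> dom T \<Longrightarrow> app T (x - y) = app T x - app T y"
proof -
  have l: "0 \<in> dom T" 
    "\<And>x y. x \<in> dom T \<Longrightarrow> y \<in> dom T \<Longrightarrow> x + y \<in> dom T \<and> app T (x + y) = app T x + app T y"
    "\<And>x c. x \<in> dom T \<Longrightarrow> c *\<^sub>C x \<in> dom T \<and> app T (c *\<^sub>C x) = c *\<^sub>C app T x"
    using assms unfolding linear_op_def by blast+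
  have "app T 0 = app T (0 *\<^sub>C 0)" by simp
  also have "\<dots> = 0 *\<^sub>C app T 0" using l by blast
  finally show "0 \<in> dom T" "app T 0 = 0" using l by simp_all
  show "x + y \<in> dom T" "app T (x + y) = app T x + app T y" if "x \<in> dom T" "y \<in> dom T"
    using l that by blast+
  show "c *\<^sub>C x \<in> dom T" "app T (c *\<^sub>C x) = c *\<^sub>C app T x" if "x \<in> dom T"
    using l that by blast+
  have eq: "x - y = x + (- 1) *\<^sub>C y" for x y :: 'a by (simp add: scaleC_minus_one)
  show "x - y \<in> dom T" "app T (x - y) = app T x - app T y" if "x \<in> dom T" "y \<in> dom T"
    unfolding eq[of x y] eq[of "app T x"] using l(2)[OF that(1)] l(3)[OF that(2)] by simp_all
qed

lemma csubspace_graph: "linear_op T \<Longrightarrow> csubspace (graph T)"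
  unfolding csubspace_def graph_def
  by (fastforce simp: scaleC_prod_def zero_prod_def linear_op_0 linear_op_add linear_op_scaleC)

lemma csubspace_imp_subspace: "csubspace S \<Longrightarrow> subspace S"
  using csubspace_scaleR by (auto simp: csubspace_def subspace_def)

lemma closed_op_limit:
  assumes "closed_op T" "\<And>n. x n \<in> dom T" "x \<longlonglongrightarrow> a" "(\<lambda>n. app T (x n)) \<longlonglongrightarrow> b"
  shows "a \<in> dom T" "app T a = b"
proof -
  have "(a, b) \<in> graph T"
    using assms(1) unfolding closed_op_def
    by (elim conjE closed_sequentially[where f = "\<lambda>n. (x n, app T (x n))"])
      (use assms in \<open>auto simp: graph_def intro: tendsto_Pair\<close>)
  then show "a \<in> dom T" "app T a = b" by (auto simp: graph_def)
qed

text \<open>On the closed subspace \<open>graph N\<close> the map sending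
  \<open>(x, app N x)\<close> to \<open>app T x\<close> is everywhere defined and inherits a closed
  graph from \<open>T\<close>, so it is bounded by the graph norm of \<open>N\<close>.\<close>

lemma closed_op_relatively_bounded:
  assumes T: "closed_op T" and N: "closed_op N" and dom: "dom N \<subseteq> dom T"
  obtains C where "C \<ge> 0" "\<And>x. x \<in> dom N \<Longrightarrow> norm (app T x) \<le> C * (norm x + norm (app N x))"
proof -
  have lT: "linear_op T" and lN: "linear_op N" and clN: "closed (graph N)"
    using T N by (auto simp: closed_op_def)
  have graph_dom: "fst p \<in> dom N" "snd p = app N (fst p)" if "p \<in> graph N" for p
    using that by (auto simp: graph_def)
  have "closed {(p, app T (fst p)) | p. p \<in> graph N}"
    unfolding closed_sequential_limits
  proof (intro allI impI)
    fix s l assume a: "(\<forall>n. s n \<in> {(p, app T (fst p)) | p. p \<in> graph N}) \<and> s \<longlonglongrightarrow> l"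
    have sn: "fst (s n) \<in> graph N" "snd (s n) = app T (fst (fst (s n)))" for n
    proof -
      obtain p where "s n = (p, app T (fst p))" "p \<in> graph N" using a by blast
      then show "fst (s n) \<in> graph N" "snd (s n) = app T (fst (fst (s n)))" by simp_all
    qed
    have lim: "(\<lambda>n. fst (s n)) \<longlonglongrightarrow> fst l" "(\<lambda>n. snd (s n)) \<longlonglongrightarrow> snd l"
      using a by (auto intro: tendsto_fst tendsto_snd)
    have g: "fst l \<in> graph N" using closed_sequentially[OF clN sn(1) lim(1)] .
    have "app T (fst (fst l)) = snd l"
      by (rule closed_op_limit(2)[OF T _ tendsto_fst[OF lim(1)]])
        (use graph_dom[OF sn(1)] dom lim(2) in \<open>auto simp flip: sn(2)\<close>)
    with g show "l \<in> {(p, app T (fst p)) | p. p \<in> graph N}"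
      by (cases l) auto
  qed
  then obtain C where C: "C \<ge> 0" "\<And>p. p \<in> graph N \<Longrightarrow> norm (app T (fst p)) \<le> C * norm p"
  proof (rule closed_graph_theorem_on[of "graph N" "\<lambda>p. app T (fst p)", rotated 4])
    show "subspace (graph N)" "closed (graph N)"
      using csubspace_imp_subspace[OF csubspace_graph[OF lN]] clN by auto
    show "app T (fst (p + q)) = app T (fst p) + app T (fst q)" if "p \<in> graph N" "q \<in> graph N" for p q
      using graph_dom(1)[OF that(1)] graph_dom(1)[OF that(2)] dom by (auto intro!: linear_op_add(2)[OF lT])
    show "app T (fst (r *\<^sub>R p)) = r *\<^sub>R app T (fst p)" if "p \<in> graph N" for p r
      using graph_dom(1)[OF that] dom linear_op_scaleC(2)[OF lT]
      by (metis fst_scaleR scaleR_scaleC subsetD)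
  qed blast
  have "norm (app T x) \<le> C * (norm x + norm (app N x))" if "x \<in> dom N" for x
  proof -
    have "norm (app T x) \<le> C * norm (x, app N x)"
      using C(2)[of "(x, app N x)"] that by (auto simp: graph_def)
    also have "\<dots> \<le> C * (norm x + norm (app N x))"
      using C(1) norm_Pair_le by (rule mult_left_mono[rotated])
    finally show ?thesis .
  qed
  with C(1) that show ?thesis by blast
qed

section \<open>Splitting a self-adjoint contraction by sign\<close>

text \<open>A fixed point \<open>Y\<close> satisfies \<open>(1 - Y)\<^sup>2 = 1 - X\<close>, so the
  iteration aims at one minus a square root of \<open>1 - X\<close>.\<close>

primrec sqrt_iter :: "('a::real_normed_vector \<Rightarrow>\<^sub>L 'a) \<Rightarrow> nat \<Rightarrow> 'a \<Rightarrow>\<^sub>L 'a" where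
  "sqrt_iter X 0 = 0"
| "sqrt_iter X (Suc n) = (1/2) *\<^sub>R (X + (sqrt_iter X n o\<^sub>L sqrt_iter X n))"

text \<open>The same iteration for the scalar \<open>X = 1\<close>; it majorises the iterates for
  every \<open>X\<close> of norm at most one.\<close>

primrec sqrt_bound :: "nat \<Rightarrow> real" where
  "sqrt_bound 0 = 0"
| "sqrt_bound (Suc n) = (1 + (sqrt_bound n)\<^sup>2) / 2"

lemma sqrt_bound_range: "0 \<le> sqrt_bound n" "sqrt_bound n \<le> 1"
proof -
  have "0 \<le> sqrt_bound n \<and> sqrt_bound n \<le> 1"
    by (induction n) (auto simp: power_le_one)
  then show "0 \<le> sqrt_bound n" "sqrt_bound n \<le> 1" by auto
qed

lemma sqrt_bound_Suc_ge: "sqrt_bound n \<le> sqrt_bound (Suc n)"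
  using zero_le_power2[of "sqrt_bound n - 1"] by (simp add: power2_diff)

interpretation blinfun_compose: bounded_bilinear "(o\<^sub>L)"
  by (rule bounded_bilinear_blinfun_compose)

lemma blinfun_compose_assoc: "(A o\<^sub>L B) o\<^sub>L C = A o\<^sub>L (B o\<^sub>L C)"
  by (rule blinfun_eqI) simp

lemma sqrt_iter_commute:
  "D o\<^sub>L X = X o\<^sub>L D \<Longrightarrow> D o\<^sub>L sqrt_iter X n = sqrt_iter X n o\<^sub>L D"
proof (induction n)
  case (Suc n)
  have "D o\<^sub>L (sqrt_iter X n o\<^sub>L sqrt_iter X n) = (sqrt_iter X n o\<^sub>L sqrt_iter X n) o\<^sub>L D"
    using Suc by (metis blinfun_compose_assoc)
  then show ?case using Suc.prems
    by (simp add: blinfun_compose.add_left blinfun_compose.add_right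
        blinfun_compose.scaleR_left blinfun_compose.scaleR_right)
qed simp

lemma norm_sqrt_iter_le:
  assumes "norm X \<le> 1"
  shows "norm (sqrt_iter X n) \<le> sqrt_bound n"
proof (induction n)
  case (Suc n)
  have "norm (X + (sqrt_iter X n o\<^sub>L sqrt_iter X n)) \<le> 1 + sqrt_bound n * sqrt_bound n"
    by (intro norm_triangle_mono order.trans[OF norm_blinfun_compose] mult_mono Suc assms sqrt_bound_range) auto
  then show ?case by (simp add: power2_eq_square)
qed simp

text \<open>Successive iterates commute, so the difference of their squares factors as for numbers
  and the scalar iteration dominates the increments.\<close>

lemma norm_sqrt_iter_Suc_diff_le:
  assumes "norm X \<le> 1"
  shows "norm (sqrt_iter X (Suc n) - sqrt_iter X n) \<le> sqrt_bound (Suc n) - sqrt_bound n"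
proof (induction n)
  case (Suc n)
  let ?P = "sqrt_iter X (Suc n)" and ?Q = "sqrt_iter X n"
  let ?p = "sqrt_bound (Suc n)" and ?q = "sqrt_bound n"
  have comm: "?P o\<^sub>L ?Q = ?Q o\<^sub>L ?P"
    using sqrt_iter_commute sqrt_iter_commute[OF refl] by metis
  have "sqrt_iter X (Suc (Suc n)) - ?P = (1/2) *\<^sub>R ((?P o\<^sub>L ?P) - (?Q o\<^sub>L ?Q))"
    by (simp only: sqrt_iter.simps) (simp add: algebra_simps)
  also have "(?P o\<^sub>L ?P) - (?Q o\<^sub>L ?Q) = (?P - ?Q) o\<^sub>L (?P + ?Q)"
    by (simp only: blinfun_compose.add_right blinfun_compose.diff_left comm) simp
  finally have "norm (sqrt_iter X (Suc (Suc n)) - ?P) \<le> (1/2) * (norm (?P - ?Q) * norm (?P + ?Q))"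
    using norm_blinfun_compose[of "?P - ?Q" "?P + ?Q"] by simp
  also have "\<dots> \<le> (1/2) * ((?p - ?q) * (?p + ?q))"
    by (intro mult_left_mono mult_mono Suc norm_triangle_mono norm_sqrt_iter_le[OF assms])
      (use sqrt_bound_Suc_ge in auto)
  also have "\<dots> = sqrt_bound (Suc (Suc n)) - ?p"
    by (simp only: sqrt_bound.simps(2)[of "Suc n"]) (simp add: algebra_simps power2_eq_square)
  finally show ?case .
qed (use assms in simp)

lemma norm_sqrt_iter_diff_le:
  assumes "norm X \<le> 1" "n \<le> m"
  shows "norm (sqrt_iter X m - sqrt_iter X n) \<le> sqrt_bound m - sqrt_bound n"
  using assms(2)
proof (induction m rule: dec_induct)
  case (step m)
  have "norm (sqrt_iter X (Suc m) - sqrt_iter X n)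
      \<le> norm (sqrt_iter X (Suc m) - sqrt_iter X m) + norm (sqrt_iter X m - sqrt_iter X n)"
    by (metis diff_add_cancel add_diff_eq norm_triangle_ineq)
  also have "\<dots> \<le> (sqrt_bound (Suc m) - sqrt_bound m) + (sqrt_bound m - sqrt_bound n)"
    by (intro add_mono norm_sqrt_iter_Suc_diff_le assms(1) step.IH)
  finally show ?case by simp
qed simp

lemma convergent_sqrt_iter:
  fixes X :: "'a::banach \<Rightarrow>\<^sub>L 'a"
  assumes "norm X \<le> 1"
  shows "convergent (sqrt_iter X)"
proof (rule Cauchy_convergent, rule metric_CauchyI)
  fix e :: real assume "e > 0"
  have "convergent sqrt_bound"
  proof (rule Bseq_mono_convergent)
    show "Bseq sqrt_bound" by (rule BseqI'[of _ 1]) (use sqrt_bound_range in simp)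
    show "\<forall>m n. m \<le> n \<longrightarrow> sqrt_bound m \<le> sqrt_bound n"
      using lift_Suc_mono_le[of sqrt_bound, OF sqrt_bound_Suc_ge] by blast
  qed
  then have "Cauchy sqrt_bound" by (rule convergent_Cauchy)
  then obtain M where M: "\<And>m n. m \<ge> M \<Longrightarrow> n \<ge> M \<Longrightarrow> dist (sqrt_bound m) (sqrt_bound n) < e"
    using \<open>e > 0\<close> metric_CauchyD by metis
  have less: "dist (sqrt_iter X m) (sqrt_iter X n) < e" if "m \<ge> M" "n \<ge> M" "n \<le> m" for m n
    using norm_sqrt_iter_diff_le[OF assms that(3)] M[OF that(1,2)]
    by (simp add: dist_norm)
  have "dist (sqrt_iter X m) (sqrt_iter X n) < e" if "m \<ge> M" "n \<ge> M" for m n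
    using less[of m n] less[of n m] that by (cases "n \<le> m") (auto simp: dist_commute)
  then show "\<exists>M. \<forall>m\<ge>M. \<forall>n\<ge>M. dist (sqrt_iter X m) (sqrt_iter X n) < e" by blast
qed

text \<open>Norm bound, symmetry and commutation hold for every iterate and survive the limit in
  operator norm.\<close>

lemma one_minus_sqrt_exists:
  fixes X :: "'a::complex_hilbert \<Rightarrow>\<^sub>L 'a"
  assumes X: "norm X \<le> 1" and sa: "\<And>x y. cinner (X x) y = cinner x (X y)"
  obtains Y :: "'a \<Rightarrow>\<^sub>L 'a" where "norm Y \<le> 1" "2 *\<^sub>R Y = X + (Y o\<^sub>L Y)"
    "\<And>x y. cinner (Y x) y = cinner x (Y y)"
    "\<And>D. D o\<^sub>L X = X o\<^sub>L D \<Longrightarrow> D o\<^sub>L Y = Y o\<^sub>L D"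
proof -
  obtain Y where Y: "sqrt_iter X \<longlonglongrightarrow> Y"
    using convergent_sqrt_iter[OF X] convergent_def by blast
  have app: "(\<lambda>n. sqrt_iter X n x) \<longlonglongrightarrow> Y x" for x
    by (rule blinfun.tendsto[OF Y tendsto_const])
  have "norm Y \<le> 1"
  proof (rule LIMSEQ_le_const2[OF tendsto_norm[OF Y]])
    show "\<exists>N. \<forall>n\<ge>N. norm (sqrt_iter X n) \<le> 1"
      using norm_sqrt_iter_le[OF X] sqrt_bound_range(2) order.trans by blast
  qed
  moreover have "Y = (1/2) *\<^sub>R (X + (Y o\<^sub>L Y))"
  proof (rule LIMSEQ_unique[OF LIMSEQ_Suc[OF Y]])
    show "(\<lambda>n. sqrt_iter X (Suc n)) \<longlonglongrightarrow> (1/2) *\<^sub>R (X + (Y o\<^sub>L Y))"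
      unfolding sqrt_iter.simps by (intro tendsto_intros blinfun_compose.tendsto Y)
  qed
  from arg_cong[OF this, of "\<lambda>B. 2 *\<^sub>R B"] have "2 *\<^sub>R Y = X + (Y o\<^sub>L Y)"
    by (simp only: scaleR_scaleR) simp
  moreover have "cinner (sqrt_iter X n x) y = cinner x (sqrt_iter X n y)" for n x y
    by (induction n arbitrary: x y) (auto simp: sa cinner_simps blinfun.add_left blinfun.scaleR_left)
  then have "cinner (Y x) y = cinner x (Y y)" for x y
    using tendsto_cinner[OF app[of x] tendsto_const[of y]] tendsto_cinner[OF tendsto_const[of x] app[of y]]
    by (simp add: LIMSEQ_unique)
  moreover have "D o\<^sub>L Y = Y o\<^sub>L D" if "D o\<^sub>L X = X o\<^sub>L D" for D
    using blinfun_compose.tendsto[OF tendsto_const[of D] Y] blinfun_compose.tendsto[OF Y tendsto_const[of D]]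
    by (simp add: LIMSEQ_unique sqrt_iter_commute[OF that])
  ultimately show ?thesis using that by blast
qed

text \<open>\<open>Z = 1 - Y\<close> is the absolute value of \<open>S\<close>, and \<open>K = ker (|S| - S)\<close>.\<close>

lemma spectral_splitting:
  fixes S :: "'a::complex_hilbert \<Rightarrow>\<^sub>L 'a"
  assumes S: "norm S \<le> 1" and sa: "\<And>x y. cinner (S x) y = cinner x (S y)"
  obtains K where "csubspace K" "closed K"
    "\<And>(D :: 'a \<Rightarrow>\<^sub>L 'a) x. D o\<^sub>L S = S o\<^sub>L D \<Longrightarrow> x \<in> K \<Longrightarrow> D x \<in> K"
    "\<And>x. x \<in> K \<Longrightarrow> 0 \<le> Re (cinner (S x) x)"
    "\<And>x. (\<And>k. k \<in> K \<Longrightarrow> cinner x k = 0) \<Longrightarrow> Re (cinner (S x) x) \<le> 0"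
proof -
  \<comment> \<open>With this \<open>X\<close> the equation for \<open>Y\<close> says that
    \<open>1 - Y\<close> has the same square as \<open>S\<close>.\<close>
  define X where "X = id_blinfun - (S o\<^sub>L S)"
  have Xx: "X x = x - S (S x)" for x by (simp add: X_def blinfun.diff_left)
  have S1: "norm (S x) \<le> norm x" for x
    using norm_blinfun[of S x] mult_right_mono[OF S, of "norm x"] by simp
  have "norm X \<le> 1"
  proof (rule norm_blinfun_bound)
    fix x
    have "(norm (X x))\<^sup>2 = (norm x)\<^sup>2 - 2 * (norm (S x))\<^sup>2 + (norm (S (S x)))\<^sup>2"
      unfolding Xx norm_diff_sq by (simp add: power2_norm_eq_cinner sa)
    also have "(norm (S (S x)))\<^sup>2 \<le> (norm (S x))\<^sup>2" using S1 by (simp add: power_mono)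
    finally have "(norm (X x))\<^sup>2 \<le> (norm x)\<^sup>2"
      using zero_le_power2[of "norm (S x)"] by linarith
    then show "norm (X x) \<le> 1 * norm x" by simp
  qed simp
  moreover have "cinner (X x) y = cinner x (X y)" for x y by (simp add: Xx cinner_simps sa)
  ultimately obtain Y :: "'a \<Rightarrow>\<^sub>L 'a" where Y1: "norm Y \<le> 1" and Y2: "2 *\<^sub>R Y = X + (Y o\<^sub>L Y)"
    and Ysa: "\<And>x y. cinner (Y x) y = cinner x (Y y)"
    and Yc: "\<And>D. D o\<^sub>L X = X o\<^sub>L D \<Longrightarrow> D o\<^sub>L Y = Y o\<^sub>L D"
    using one_minus_sqrt_exists by metis
  define Z where "Z = id_blinfun - Y"
  have Zx: "Z x = x - Y x" for x by (simp add: Z_def blinfun.diff_left)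
  have Zsq: "Z (Z x) = S (S x)" for x
  proof -
    have "2 *\<^sub>R Y x = X x + Y (Y x)"
      using arg_cong[OF Y2, of "\<lambda>B. blinfun_apply B x"] by (simp add: blinfun.add_left blinfun.scaleR_left)
    then show ?thesis by (simp add: Zx Xx blinfun.diff_right algebra_simps scaleR_2)
  qed
  have Zsa: "cinner (Z x) y = cinner x (Z y)" for x y by (simp add: Zx cinner_simps Ysa)
  have Zpos: "0 \<le> Re (cinner (Z x) x)" for x
  proof -
    have "norm (Y x) \<le> norm x"
      using norm_blinfun[of Y x] mult_right_mono[OF Y1, of "norm x"] by simp
    then have "Re (cinner (Y x) x) \<le> norm x * norm x"
      using Re_cinner_le[of "Y x" x] mult_right_mono[of "norm (Y x)" "norm x" "norm x"] by simp
    then show ?thesis by (simp add: Zx cinner_diff_left cinner_self_norm power2_eq_square)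
  qed
  have Zc: "D (Z x) = Z (D x)" if "D o\<^sub>L S = S o\<^sub>L D" for D x
  proof -
    have ap: "D (S x) = S (D x)" for x
      using arg_cong[OF that, of "\<lambda>B. blinfun_apply B x"] by simp
    have "D o\<^sub>L X = X o\<^sub>L D"
      by (rule blinfun_eqI) (simp add: Xx blinfun.diff_right ap)
    from arg_cong[OF Yc[OF this], of "\<lambda>B. blinfun_apply B x"]
    show ?thesis by (simp add: Zx blinfun.diff_right)
  qed
  define K where "K = {x. Z x = S x}"
  have inv: "D x \<in> K" if "D o\<^sub>L S = S o\<^sub>L D" "x \<in> K" for D x
    using Zc[OF that(1), of x] arg_cong[OF that(1), of "\<lambda>B. blinfun_apply B x"] that(2)
    by (simp add: K_def)
  have cl: "closed K"
    unfolding K_def by (intro closed_Collect_eq continuous_intros)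
  have "c *\<^sub>C x \<in> K" if "x \<in> K" for c x
  proof -
    \<comment> \<open>The operators here are only real linear by type. Multiplication by
      \<open>c\<close> is treated as one more operator commuting with \<open>S\<close>; the
      commutation comes from self-adjointness.\<close>
    have b: "blinfun_apply (Blinfun (\<lambda>x. c *\<^sub>C x)) x = c *\<^sub>C x" for x :: 'a
      by (simp add: bounded_linear_Blinfun_apply bounded_linear_scaleC)
    have "c *\<^sub>C S x = S (c *\<^sub>C x)" for x
    proof -
      have "cinner (c *\<^sub>C S x - S (c *\<^sub>C x)) y = 0" for y by (simp add: cinner_simps sa)
      then show ?thesis using cinner_eq_zero_imp eq_iff_diff_eq_0 by blast
    qed
    then have "Blinfun (\<lambda>x. c *\<^sub>C x) o\<^sub>L S = S o\<^sub>L Blinfun (\<lambda>x. c *\<^sub>C x)"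
      by (intro blinfun_eqI) (simp add: b)
    from inv[OF this that] show ?thesis by (simp add: b)
  qed
  then have sub: "csubspace K"
    by (auto simp: csubspace_def K_def blinfun.add_right blinfun.zero_right)
  have pos: "0 \<le> Re (cinner (S x) x)" if "x \<in> K" for x
    using Zpos[of x] that by (simp add: K_def)
  have neg: "Re (cinner (S x) x) \<le> 0" if perp: "\<And>k. k \<in> K \<Longrightarrow> cinner x k = 0" for x
  proof -
    \<comment> \<open>\<open>Z\<close> and \<open>S\<close> commute and have equal squares, so
      \<open>Z - S\<close> annihilates the range of \<open>Z + S\<close>. A vector orthogonal to
      \<open>K\<close> is orthogonal to that range, hence in the kernel of the self-adjoint
      \<open>Z + S\<close>.\<close>
    have "Z w + S w \<in> K" for w
      using Zc[OF refl, of w] by (simp add: K_def blinfun.add_right Zsq)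
    then have "cinner (Z x + S x) w = 0" for w
      using perp[of "Z w + S w"] by (simp add: cinner_simps Zsa sa)
    then have "Z x + S x = 0" using cinner_eq_zero_imp by blast
    then have "S x = - Z x" by (simp add: eq_neg_iff_add_eq_0 add.commute)
    then show ?thesis using Zpos[of x] by (simp add: cinner_minus_left)
  qed
  show ?thesis using that[OF sub cl inv pos neg] by blast
qed

section \<open>The Fuglede argument for bounded operators\<close>

lemma funpow_commute_on:
  assumes "\<And>x. f (g x) = g (f x)"
  shows "(f ^^ k) (g x) = g ((f ^^ k) x)"
  using assms by (induction k) auto

lemma funpow_comp_distrib:
  assumes "\<And>x. f (g x) = g (f x)"
  shows "(f ^^ k) ((g ^^ k) x) = ((\<lambda>x. f (g x)) ^^ k) x"
proof (induction k arbitrary: x)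
  case (Suc k)
  have "(f ^^ Suc k) ((g ^^ Suc k) x) = f ((f ^^ k) (g ((g ^^ k) x)))" by simp
  also have "\<dots> = f (g ((f ^^ k) ((g ^^ k) x)))" by (simp only: funpow_commute_on[of f g, OF assms])
  finally show ?case by (simp add: Suc)
qed simp

lemma norm_funpow_le:
  fixes f :: "'a::real_normed_vector \<Rightarrow> 'a"
  assumes "\<And>x. norm (f x) \<le> b * norm x" "0 \<le> b"
  shows "norm ((f ^^ k) x) \<le> b ^ k * norm x"
proof (induction k)
  case (Suc k)
  have "norm ((f ^^ Suc k) x) \<le> b * norm ((f ^^ k) x)"
    using assms(1)[of "(f ^^ k) x"] by simp
  also have "\<dots> \<le> b * (b ^ k * norm x)" by (intro mult_left_mono Suc assms)
  finally show ?case by (simp add: mult.assoc)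
qed simp

lemma norm_funpow_minus_id_le:
  fixes f :: "'a::real_normed_vector \<Rightarrow> 'a"
  assumes "\<And>x. norm (f x - x) \<le> b * norm x" "0 \<le> b"
  shows "norm ((f ^^ k) x - x) \<le> ((1 + b) ^ k - 1) * norm x"
proof (induction k)
  case (Suc k)
  have f: "norm (f x) \<le> (1 + b) * norm x" for x
    using norm_triangle_ineq[of "f x - x" x] assms(1)[of x] by (simp add: distrib_right)
  have "norm ((f ^^ Suc k) x - x) \<le> norm (f ((f ^^ k) x) - (f ^^ k) x) + norm ((f ^^ k) x - x)"
    using norm_triangle_ineq[of "f ((f ^^ k) x) - (f ^^ k) x" "(f ^^ k) x - x"] by simp
  also have "\<dots> \<le> b * ((1 + b) ^ k * norm x) + ((1 + b) ^ k - 1) * norm x"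
    using assms by (intro add_mono Suc order.trans[OF assms(1)] mult_left_mono norm_funpow_le[OF f]) auto
  finally show ?case by (simp add: algebra_simps)
qed simp

lemma one_plus_power_le_exp: "0 \<le> x \<Longrightarrow> (1 + x) ^ k \<le> exp (real k * x)" for x :: real
  by (metis add_nonneg_nonneg exp_ge_add_one_self exp_of_nat_mult power_mono zero_le_one)

definition clinear :: "('a::complex_hilbert \<Rightarrow> 'a) \<Rightarrow> bool" where
  "clinear f \<longleftrightarrow> (\<forall>x y. f (x + y) = f x + f y) \<and> (\<forall>c x. f (c *\<^sub>C x) = c *\<^sub>C f x)"

lemma clinear_funpow: "clinear f \<Longrightarrow> clinear (f ^^ k)"
  by (induction k) (auto simp: clinear_def)

lemma
  assumes "clinear f"
  shows clinear_add: "f (x + y) = f x + f y" and clinear_scaleC: "f (c *\<^sub>C x) = c *\<^sub>C f x"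
    and clinear_diff: "f (x - y) = f x - f y"
proof -
  show a: "f (x + y) = f x + f y" and s: "f (c *\<^sub>C x) = c *\<^sub>C f x" for x y c
    using assms by (auto simp: clinear_def)
  show "f (x - y) = f x - f y" using a[of x "(-1) *\<^sub>C y"] s[of "-1" y] by (simp add: scaleC_minus_one)
qed

text \<open>Here \<open>m\<close> is the adjoint of \<open>n\<close>. Both are total functions, so
  an unbounded operator composed with the projection onto a cut-off fits.\<close>

locale bounded_normal =
  fixes n m :: "'a::complex_hilbert \<Rightarrow> 'a" and r :: real
  assumes n: "clinear n" and m: "clinear m"
    and adj: "cinner (n x) y = cinner x (m y)"
    and comm: "n (m x) = m (n x)"
    and bn: "norm (n x) \<le> r * norm x" and bm: "norm (m x) \<le> r * norm x"
    and r: "0 \<le> r"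
begin

text \<open>To first order these three are the exponentials of \<open>- cnj z\<close> times
  \<open>m\<close>, of \<open>z\<close> times \<open>n\<close> and of \<open>cnj z\<close> times
  \<open>m\<close>. The conjugate in \<open>P\<close> makes a form that is conjugate linear on the
  left holomorphic in \<open>z\<close>. \<open>S z\<close> is the adjoint of \<open>Q z\<close> and
  inverts \<open>P z\<close> up to second order.\<close>

definition P where "P z x = x - cnj z *\<^sub>C m x"
definition Q where "Q z x = x + z *\<^sub>C n x"
definition S where "S z x = x + cnj z *\<^sub>C m x"

lemmas lin = clinear_add[OF n] clinear_add[OF m] clinear_scaleC[OF n] clinear_scaleC[OF m]
  clinear_diff[OF n] clinear_diff[OF m]

lemma clinear_P: "clinear (P z)" and clinear_Q: "clinear (Q z)"
  by (auto simp: clinear_def P_def Q_def lin scaleC_scaleC scaleC_add_right scaleC_diff_right mult.commute)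

lemma P_0: "(P 0 ^^ k) x = x" and Q_0: "(Q 0 ^^ k) x = x"
  by (induction k) (auto simp: P_def Q_def)

lemma
  shows Q_P: "Q z (P z x) = P z (Q z x)" and Q_S: "Q z (S z x) = S z (Q z x)"
    and S_P: "S z (P z x) = x - (cnj z * cnj z) *\<^sub>C m (m x)" "S z (P z x) = P z (S z x)"
  by (simp_all add: P_def Q_def S_def lin scaleC_add_right scaleC_diff_right scaleC_scaleC comm mult.commute)

lemma norm_P_le: "norm (P z x) \<le> (1 + cmod z * r) * norm x"
  and norm_Q_le: "norm (Q z x) \<le> (1 + cmod z * r) * norm x"
proof -
  have "norm (P z x) \<le> norm x + cmod z * norm (m x)" "norm (Q z x) \<le> norm x + cmod z * norm (n x)"
    using norm_triangle_ineq4[of x "cnj z *\<^sub>C m x"] norm_triangle_ineq[of x "z *\<^sub>C n x"]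
    by (simp_all add: P_def Q_def norm_scaleC)
  moreover have "cmod z * norm (m x) \<le> cmod z * (r * norm x)" "cmod z * norm (n x) \<le> cmod z * (r * norm x)"
    by (intro mult_left_mono bm bn; simp)+
  ultimately show "norm (P z x) \<le> (1 + cmod z * r) * norm x" "norm (Q z x) \<le> (1 + cmod z * r) * norm x"
    by (simp_all add: algebra_simps)
qed

lemma norm_S_P_minus_le: "norm (S z (P z x) - x) \<le> (cmod z * r)\<^sup>2 * norm x"
proof -
  have "norm (S z (P z x) - x) = (cmod z)\<^sup>2 * norm (m (m x))"
    by (simp add: S_P(1) norm_scaleC norm_mult power2_eq_square)
  also have "\<dots> \<le> (cmod z)\<^sup>2 * (r * (r * norm x))"
    using r by (intro mult_left_mono order.trans[OF bm] bm) auto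
  finally show ?thesis by (simp add: power2_eq_square algebra_simps)
qed

text \<open>\<open>Q z P z\<close> differs from a unitary operator only in second order, since
  \<open>z N - cnj z N*\<close> is skew-adjoint.\<close>

lemma norm_Q_P_le: "norm (Q z (P z x)) \<le> (1 + 3 * (cmod z * r)\<^sup>2) * norm x"
proof -
  define t where "t = cmod z * r"
  define k where "k = z *\<^sub>C n x - cnj z *\<^sub>C m x"
  have t: "t \<ge> 0" using r by (simp add: t_def)
  have "cinner x (m x) = cnj (cinner x (n x))" by (metis adj cinner_commute)
  then have skew: "Re (cinner x k) = 0" by (simp add: k_def cinner_simps)
  have zn: "norm (z *\<^sub>C n x) \<le> t * norm x" "norm (cnj z *\<^sub>C m x) \<le> t * norm x"
    unfolding norm_scaleC t_def using mult_left_mono[OF bn, of "cmod z" x] mult_left_mono[OF bm, of "cmod z" x]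
    by (simp_all add: mult.assoc)
  have "norm k \<le> 2 * t * norm x"
    using norm_triangle_ineq4[of "z *\<^sub>C n x" "cnj z *\<^sub>C m x"] zn unfolding k_def by linarith
  then have "(norm k)\<^sup>2 \<le> (2 * t * norm x)\<^sup>2" by (intro power_mono) auto
  \<comment> \<open>The cross term vanishes by skewness, and
    \<open>1 + 4 * t\<^sup>2 \<le> (1 + 2 * t\<^sup>2)\<^sup>2\<close>. The term with
    \<open>z * cnj z\<close> adds the third \<open>t\<^sup>2\<close>.\<close>
  then have "(norm (x + k))\<^sup>2 \<le> (norm x)\<^sup>2 + (2 * t * norm x)\<^sup>2"
    by (simp add: norm_add_sq skew)
  also have "\<dots> \<le> ((1 + 2 * t\<^sup>2) * norm x)\<^sup>2"
    using zero_le_power2[of "2 * t\<^sup>2 * norm x"] by (simp add: power2_eq_square algebra_simps)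
  finally have xk: "norm (x + k) \<le> (1 + 2 * t\<^sup>2) * norm x"
    by (rule power2_le_imp_le) simp
  have "norm (n (m x)) \<le> r * (r * norm x)"
    by (rule order.trans[OF bn]) (intro mult_left_mono bm r)
  then have "norm ((z * cnj z) *\<^sub>C n (m x)) \<le> (cmod z * cmod z) * (r * (r * norm x))"
    unfolding norm_scaleC norm_mult complex_mod_cnj by (intro mult_left_mono) auto
  then have nm: "norm ((z * cnj z) *\<^sub>C n (m x)) \<le> t\<^sup>2 * norm x"
    by (simp add: t_def power2_eq_square algebra_simps)
  have "Q z (P z x) = (x + k) - (z * cnj z) *\<^sub>C n (m x)"
    by (simp add: P_def Q_def k_def lin scaleC_diff_right scaleC_scaleC)
  then have "norm (Q z (P z x)) \<le> norm (x + k) + norm ((z * cnj z) *\<^sub>C n (m x))"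
    by (metis norm_triangle_ineq4)
  also have "\<dots> \<le> (1 + 3 * t\<^sup>2) * norm x" using xk nm by (simp add: algebra_simps)
  finally show ?thesis by (simp add: t_def)
qed

end

text \<open>The two arguments carry separate normal pairs because they may come from different
  cut-offs. For a form built from \<open>T\<close>, \<open>intertwine\<close> is the weak version of
  \<open>T N = N T\<close>.\<close>

locale intertwining_form = V: bounded_normal n1 m1 r + W: bounded_normal n2 m2 r
  for n1 m1 n2 m2 :: "'a::complex_hilbert \<Rightarrow> 'a" and r :: real +
  fixes \<phi> :: "'a \<Rightarrow> 'a \<Rightarrow> complex" and M :: real
  assumes add_left: "\<phi> (x + y) w = \<phi> x w + \<phi> y w"
    and scale_left: "\<phi> (c *\<^sub>C x) w = cnj c * \<phi> x w"
    and add_right: "\<phi> x (y + w) = \<phi> x y + \<phi> x w"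
    and scale_right: "\<phi> x (c *\<^sub>C w) = c * \<phi> x w"
    and bound: "cmod (\<phi> x w) \<le> M * norm x * norm w" and M: "0 \<le> M"
    and intertwine: "\<phi> (n1 x) w = \<phi> x (m2 w)"
begin

lemma diff_left: "\<phi> (x - y) w = \<phi> x w - \<phi> y w"
  using add_left[of "x - y" y w] by simp

lemma diff_right: "\<phi> x (y - w) = \<phi> x y - \<phi> x w"
  using add_right[of x "y - w" w] by simp

lemma move_Q: "\<phi> ((V.Q z ^^ k) x) w = \<phi> x ((W.S z ^^ k) w)"
proof (induction k arbitrary: x w)
  case (Suc k)
  have "\<phi> ((V.Q z ^^ Suc k) x) w = \<phi> ((V.Q z ^^ k) x) (W.S z w)"
    by (simp add: V.Q_def W.S_def add_left scale_left add_right scale_right intertwine)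
  then show ?case by (simp add: Suc funpow_swap1)
qed simp

text \<open>Bounding the powers separately would give growth exponential in \<open>k * t\<close>.
  Instead \<open>V.Q z ^^ k\<close> is inserted on the left and \<open>W.P z ^^ k\<close> on the
  right, which makes both arguments nearly unitary images. Moved across the form, the left insertion
  nearly cancels the right one and leaves \<open>H\<close> close to \<open>w\<close>.\<close>

lemma form_bound:
  fixes z k defines "t \<equiv> cmod z * r"
  shows "cmod (\<phi> ((V.P z ^^ k) v) ((W.Q z ^^ k) w))
    \<le> M * norm v * norm w * (((1 + 3 * t\<^sup>2) ^ k)\<^sup>2 + ((1 + t) ^ k)\<^sup>2 * ((1 + t\<^sup>2) ^ k - 1))"
proof -
  have t: "t \<ge> 0" using V.r by (simp add: t_def)
  define H where "H = ((\<lambda>x. W.S z (W.P z x)) ^^ k) w"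
  have eq: "\<phi> ((V.Q z ^^ k) ((V.P z ^^ k) v)) ((W.Q z ^^ k) ((W.P z ^^ k) w))
      = \<phi> ((V.P z ^^ k) v) ((W.Q z ^^ k) H)"
  proof -
    have "(W.S z ^^ k) ((W.Q z ^^ k) ((W.P z ^^ k) w)) = (W.Q z ^^ k) ((W.S z ^^ k) ((W.P z ^^ k) w))"
      using W.Q_S by (intro funpow_commute_on funpow_commute_on[symmetric]) (metis funpow_commute_on)
    then show ?thesis by (simp add: move_Q H_def funpow_comp_distrib W.S_P(2))
  qed
  have norms: "norm ((V.Q z ^^ k) ((V.P z ^^ k) v)) \<le> (1 + 3 * t\<^sup>2) ^ k * norm v"
    "norm ((W.Q z ^^ k) ((W.P z ^^ k) w)) \<le> (1 + 3 * t\<^sup>2) ^ k * norm w"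
    unfolding funpow_comp_distrib[of "V.Q z" "V.P z", OF V.Q_P] funpow_comp_distrib[of "W.Q z" "W.P z", OF W.Q_P] t_def
    by (intro norm_funpow_le V.norm_Q_P_le W.norm_Q_P_le; simp)+
  have 1: "cmod (\<phi> ((V.P z ^^ k) v) ((W.Q z ^^ k) H))
      \<le> M * ((1 + 3 * t\<^sup>2) ^ k * norm v) * ((1 + 3 * t\<^sup>2) ^ k * norm w)"
    unfolding eq[symmetric]
    by (intro order.trans[OF bound] mult_mono mult_left_mono norms M mult_nonneg_nonneg) auto
  have "norm (w - H) \<le> ((1 + t\<^sup>2) ^ k - 1) * norm w"
    unfolding H_def t_def norm_minus_commute[of w]
    by (rule norm_funpow_minus_id_le[OF W.norm_S_P_minus_le]) simp
  moreover have "norm ((W.Q z ^^ k) (w - H)) \<le> (1 + t) ^ k * norm (w - H)"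
    using t unfolding t_def by (intro norm_funpow_le W.norm_Q_le) simp
  ultimately have H: "norm ((W.Q z ^^ k) (w - H)) \<le> (1 + t) ^ k * (((1 + t\<^sup>2) ^ k - 1) * norm w)"
    using t by (meson order.trans mult_left_mono zero_le_power add_nonneg_nonneg zero_le_one)
  have Pv: "norm ((V.P z ^^ k) v) \<le> (1 + t) ^ k * norm v"
    using t unfolding t_def by (intro norm_funpow_le V.norm_P_le) simp
  have 2: "cmod (\<phi> ((V.P z ^^ k) v) ((W.Q z ^^ k) (w - H)))
      \<le> M * ((1 + t) ^ k * norm v) * ((1 + t) ^ k * (((1 + t\<^sup>2) ^ k - 1) * norm w))"
    using t by (intro order.trans[OF bound] mult_mono mult_left_mono Pv H M mult_nonneg_nonneg) auto
  \<comment> \<open>The first summand has the nearly unitary bound; the second grows with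
    \<open>(1 + t) ^ k\<close> but carries the small factor
    \<open>(1 + t\<^sup>2) ^ k - 1\<close>.\<close>
  have "\<phi> ((V.P z ^^ k) v) ((W.Q z ^^ k) w)
     = \<phi> ((V.P z ^^ k) v) ((W.Q z ^^ k) H) + \<phi> ((V.P z ^^ k) v) ((W.Q z ^^ k) (w - H))"
    by (simp add: clinear_diff[OF clinear_funpow[OF W.clinear_Q]] diff_right)
  then have "cmod (\<phi> ((V.P z ^^ k) v) ((W.Q z ^^ k) w)) \<le>
      M * ((1 + 3 * t\<^sup>2) ^ k * norm v) * ((1 + 3 * t\<^sup>2) ^ k * norm w)
    + M * ((1 + t) ^ k * norm v) * ((1 + t) ^ k * (((1 + t\<^sup>2) ^ k - 1) * norm w))"
    using 1 2 by (metis norm_triangle_mono)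
  also have "\<dots> = M * norm v * norm w * (((1 + 3 * t\<^sup>2) ^ k)\<^sup>2 + ((1 + t) ^ k)\<^sup>2 * ((1 + t\<^sup>2) ^ k - 1))"
    by (simp add: power2_eq_square algebra_simps)
  finally show ?thesis .
qed

text \<open>With \<open>z = \<zeta> / k\<close> the quantity \<open>k * t\<^sup>2\<close> is
  \<open>\<rho>\<^sup>2 / k\<close>. For fixed \<open>\<rho>\<close> the exponentials with
  \<open>k\<close> in them tend to one, while the crude growth stays at
  \<open>exp (2 * \<rho>)\<close>.\<close>

lemma form_bound_exp:
  fixes \<zeta> :: complex
  assumes k: "k > 0"
  defines "\<rho> \<equiv> cmod \<zeta> * r"
  shows "cmod (\<phi> ((V.P (1 / of_nat k * \<zeta>) ^^ k) v) ((W.Q (1 / of_nat k * \<zeta>) ^^ k) w))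
    \<le> M * norm v * norm w * (exp (6 * \<rho>\<^sup>2 / k) + exp (2 * \<rho>) * (exp (\<rho>\<^sup>2 / k) - 1))"
proof -
  define t where "t = cmod (1 / of_nat k * \<zeta>) * r"
  have t: "t = \<rho> / k" "t \<ge> 0" using V.r by (simp_all add: t_def \<rho>_def norm_mult norm_divide)
  have e1: "((1 + 3 * t\<^sup>2) ^ k)\<^sup>2 \<le> exp (6 * \<rho>\<^sup>2 / k)"
  proof -
    have "((1 + 3 * t\<^sup>2) ^ k)\<^sup>2 \<le> (exp (k * (3 * t\<^sup>2)))\<^sup>2"
      by (intro power_mono one_plus_power_le_exp) auto
    also have "\<dots> = exp (6 * \<rho>\<^sup>2 / k)"
      using k by (simp add: t power2_eq_square flip: exp_add)
    finally show ?thesis .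
  qed
  have e2: "((1 + t) ^ k)\<^sup>2 \<le> exp (2 * \<rho>)"
  proof -
    have "((1 + t) ^ k)\<^sup>2 \<le> (exp (k * t))\<^sup>2"
      using t(2) by (intro power_mono one_plus_power_le_exp) auto
    also have "\<dots> = exp (2 * \<rho>)"
      using k by (simp add: t power2_eq_square flip: exp_add)
    finally show ?thesis .
  qed
  have e3: "(1 + t\<^sup>2) ^ k - 1 \<le> exp (\<rho>\<^sup>2 / k) - 1"
    using one_plus_power_le_exp[of "t\<^sup>2" k] k by (simp add: t power2_eq_square)
  have "1 \<le> (1 + t\<^sup>2) ^ k" by (rule one_le_power) simp
  then have "((1 + 3 * t\<^sup>2) ^ k)\<^sup>2 + ((1 + t) ^ k)\<^sup>2 * ((1 + t\<^sup>2) ^ k - 1)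
      \<le> exp (6 * \<rho>\<^sup>2 / k) + exp (2 * \<rho>) * (exp (\<rho>\<^sup>2 / k) - 1)"
    by (intro add_mono mult_mono e1 e2 e3) auto
  then show ?thesis
    by (intro order.trans[OF form_bound] mult_left_mono mult_nonneg_nonneg M) (auto simp: t_def)
qed

text \<open>Peeling off one factor replaces \<open>v\<close> by \<open>m1 v\<close> or
  \<open>w\<close> by \<open>n2 w\<close>, so the induction varies the vectors and keeps two
  independent exponents.\<close>

lemma form_derivative:
  "(\<lambda>\<zeta>. \<phi> ((V.P (s * \<zeta>) ^^ i) v) ((W.Q (s * \<zeta>) ^^ j) w)) holomorphic_on UNIV \<and>
   ((\<lambda>\<zeta>. \<phi> ((V.P (s * \<zeta>) ^^ i) v) ((W.Q (s * \<zeta>) ^^ j) w)) has_field_derivative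
      s * (of_nat j * \<phi> v (n2 w) - of_nat i * \<phi> (m1 v) w)) (at 0)"
proof (induction i arbitrary: v)
  case 0
  show ?case
  proof (induction j arbitrary: w)
    case (Suc j)
    let ?f = "\<lambda>w \<zeta>. \<phi> v ((W.Q (s * \<zeta>) ^^ j) w)"
    have f: "\<phi> ((V.P (s * \<zeta>) ^^ 0) v) ((W.Q (s * \<zeta>) ^^ Suc j) w) = ?f w \<zeta> + s * \<zeta> * ?f (n2 w) \<zeta>" for \<zeta>
    proof -
      have "(W.Q (s * \<zeta>) ^^ Suc j) w = (W.Q (s * \<zeta>) ^^ j) w + (s * \<zeta>) *\<^sub>C (W.Q (s * \<zeta>) ^^ j) (n2 w)"
        unfolding funpow_Suc_right o_apply W.Q_def[of _ w]
        using clinear_funpow[OF W.clinear_Q] by (simp add: clinear_def)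
      then show ?thesis by (simp add: add_right scale_right)
    qed
    have "((\<lambda>\<zeta>. ?f w \<zeta> + s * \<zeta> * ?f (n2 w) \<zeta>) has_field_derivative
        s * (of_nat j * \<phi> v (n2 w)) + s * ?f (n2 w) 0) (at 0)"
      using Suc[of w] Suc[of "n2 w"] by (auto intro!: derivative_eq_intros)
    then have "((\<lambda>\<zeta>. ?f w \<zeta> + s * \<zeta> * ?f (n2 w) \<zeta>) has_field_derivative
        s * (of_nat (Suc j) * \<phi> v (n2 w) - of_nat 0 * \<phi> (m1 v) w)) (at 0)"
      by (simp add: W.Q_0 algebra_simps)
    moreover have "(\<lambda>\<zeta>. ?f w \<zeta> + s * \<zeta> * ?f (n2 w) \<zeta>) holomorphic_on UNIV"
      using Suc[of w] Suc[of "n2 w"] by (auto intro!: holomorphic_intros)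
    ultimately show ?case unfolding f by blast
  qed simp
next
  case (Suc i)
  let ?f = "\<lambda>v \<zeta>. \<phi> ((V.P (s * \<zeta>) ^^ i) v) ((W.Q (s * \<zeta>) ^^ j) w)"
  have f: "\<phi> ((V.P (s * \<zeta>) ^^ Suc i) v) ((W.Q (s * \<zeta>) ^^ j) w) = ?f v \<zeta> - s * \<zeta> * ?f (m1 v) \<zeta>" for \<zeta>
  proof -
    have "(V.P (s * \<zeta>) ^^ Suc i) v = (V.P (s * \<zeta>) ^^ i) v - cnj (s * \<zeta>) *\<^sub>C (V.P (s * \<zeta>) ^^ i) (m1 v)"
      unfolding funpow_Suc_right o_apply V.P_def[of _ v]
      by (simp add: clinear_diff[OF clinear_funpow[OF V.clinear_P]] clinear_scaleC[OF clinear_funpow[OF V.clinear_P]])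
    then show ?thesis by (simp add: diff_left scale_left)
  qed
  have "((\<lambda>\<zeta>. ?f v \<zeta> - s * \<zeta> * ?f (m1 v) \<zeta>) has_field_derivative
      s * (of_nat j * \<phi> v (n2 w) - of_nat i * \<phi> (m1 v) w) - s * ?f (m1 v) 0) (at 0)"
    using Suc[of v] Suc[of "m1 v"] by (auto intro!: derivative_eq_intros)
  then have "((\<lambda>\<zeta>. ?f v \<zeta> - s * \<zeta> * ?f (m1 v) \<zeta>) has_field_derivative
      s * (of_nat j * \<phi> v (n2 w) - of_nat (Suc i) * \<phi> (m1 v) w)) (at 0)"
    by (simp add: W.Q_0 V.P_0 algebra_simps)
  moreover have "(\<lambda>\<zeta>. ?f v \<zeta> - s * \<zeta> * ?f (m1 v) \<zeta>) holomorphic_on UNIV"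
    using Suc[of v] Suc[of "m1 v"] by (auto intro!: holomorphic_intros)
  ultimately show ?case unfolding f by blast
qed

theorem adjoint_intertwine: "\<phi> (m1 v) w = \<phi> v (n2 w)"
proof -
  define D where "D = \<phi> v (n2 w) - \<phi> (m1 v) w"
  define B where "B = M * norm v * norm w"
  have cauchy: "cmod D \<le> B * (exp (6 * (R * r)\<^sup>2 / k) + exp (2 * (R * r)) * (exp ((R * r)\<^sup>2 / k) - 1)) / R"
    if R: "R > 0" and k: "k > 0" for R :: real and k :: nat
  proof -
    let ?F = "\<lambda>\<zeta>. \<phi> ((V.P (1 / of_nat k * \<zeta>) ^^ k) v) ((W.Q (1 / of_nat k * \<zeta>) ^^ k) w)"
    \<comment> \<open>The scale \<open>1 / k\<close> offsets the number of factors, so the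
      derivative at 0 is the same \<open>D\<close> for every \<open>k\<close>.\<close>
    have "1 / of_nat k * (of_nat k * \<phi> v (n2 w) - of_nat k * \<phi> (m1 v) w) = D"
      using k by (simp add: D_def field_simps)
    then have hol: "?F holomorphic_on UNIV" and der: "(?F has_field_derivative D) (at 0)"
      using form_derivative[where s = "1 / of_nat k" and i = k and j = k and v = v and w = w] by simp_all
    have "norm ((deriv ^^ 1) ?F 0)
        \<le> fact 1 * (B * (exp (6 * (R * r)\<^sup>2 / k) + exp (2 * (R * r)) * (exp ((R * r)\<^sup>2 / k) - 1))) / R ^ 1"
    proof (rule Cauchy_inequality[OF _ _ R])
      show "?F holomorphic_on ball 0 R" "continuous_on (cball 0 R) ?F"
        using hol holomorphic_on_imp_continuous_on holomorphic_on_subset by (blast, metis subset_UNIV)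
      show "cmod (?F \<zeta>) \<le> B * (exp (6 * (R * r)\<^sup>2 / k) + exp (2 * (R * r)) * (exp ((R * r)\<^sup>2 / k) - 1))"
        if "cmod (0 - \<zeta>) = R" for \<zeta>
        using form_bound_exp[OF k, of \<zeta> v w] that by (simp add: B_def)
    qed
    then show ?thesis using DERIV_imp_deriv[OF der] by simp
  qed
  \<comment> \<open>\<open>R\<close> stays fixed while \<open>k\<close> grows: the large
    \<open>exp (2 * ?\<rho>)\<close> is then multiplied by a factor tending to zero. Only afterwards
    does \<open>R\<close> grow.\<close>
  have D_le: "cmod D \<le> B / R" if R: "R > 0" for R
  proof (rule tendsto_lowerbound)
    let ?\<rho> = "R * r"
    have z: "(\<lambda>k. c / real k) \<longlonglongrightarrow> 0" for c
      by (rule tendsto_divide_0[OF tendsto_const]) (simp add: filterlim_at_top_imp_at_infinity filterlim_real_sequentially)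
    have "(\<lambda>k. B * (exp (6 * ?\<rho>\<^sup>2 / real k) + exp (2 * ?\<rho>) * (exp (?\<rho>\<^sup>2 / real k) - 1)) / R)
       \<longlonglongrightarrow> B * (exp 0 + exp (2 * ?\<rho>) * (exp 0 - 1)) / R"
      using R by (intro tendsto_intros z) auto
    then show "(\<lambda>k. B * (exp (6 * ?\<rho>\<^sup>2 / real k) + exp (2 * ?\<rho>) * (exp (?\<rho>\<^sup>2 / real k) - 1)) / R)
       \<longlonglongrightarrow> B / R" by simp
    show "\<forall>\<^sub>F k in sequentially. cmod D \<le>
        B * (exp (6 * ?\<rho>\<^sup>2 / real k) + exp (2 * ?\<rho>) * (exp (?\<rho>\<^sup>2 / real k) - 1)) / R"
      using eventually_gt_at_top[of 0] by eventually_elim (rule cauchy[OF R])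
  qed simp
  have "cmod D \<le> 0"
  proof (rule tendsto_lowerbound)
    show "((\<lambda>R. B / R) \<longlongrightarrow> 0) at_top"
      by (rule tendsto_divide_0[OF tendsto_const]) (simp add: filterlim_at_top_imp_at_infinity filterlim_ident)
    show "\<forall>\<^sub>F R in at_top. cmod D \<le> B / R"
      using eventually_gt_at_top[of 0] by eventually_elim (rule D_le)
  qed simp
  then show ?thesis by (simp add: D_def)
qed

end

section \<open>Spectral cut-offs of an unbounded normal operator\<close>

lemma dense_imp_orthogonal_zero:
  assumes "closure D = UNIV" "\<And>x. x \<in> D \<Longrightarrow> cinner x (w::'a::complex_hilbert) = 0"
  shows "w = 0"
proof -
  obtain x where x: "\<And>n. x n \<in> D" "x \<longlonglongrightarrow> w"
    using assms(1) closure_sequential[of w D] by auto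
  have "(\<lambda>n. cinner (x n) w) \<longlonglongrightarrow> cinner w w" by (intro tendsto_cinner x(2) tendsto_const)
  then have "(\<lambda>n. 0) \<longlonglongrightarrow> cinner w w" using assms(2)[OF x(1)] by simp
  from LIMSEQ_unique[OF this tendsto_const] have "cinner w w = 0" .
  then show ?thesis by (simp add: cinner_self_norm)
qed

text \<open>Density makes the vector described by \<open>THE\<close> unique, so one identity tested
  on \<open>dom N\<close> yields membership and value together.\<close>

lemma adjoint_eqI:
  assumes N: "densely_defined N" and z: "\<And>x. x \<in> dom N \<Longrightarrow> cinner (app N x) y = cinner x z"
  shows "y \<in> dom (adjoint N)" "app (adjoint N) y = z"
proof -
  show "y \<in> dom (adjoint N)" using z unfolding adjoint_def dom_def by auto
  have "(THE z. \<forall>x\<in>dom N. cinner (app N x) y = cinner x z) = z"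
  proof (rule the_equality)
    fix z' assume z': "\<forall>x\<in>dom N. cinner (app N x) y = cinner x z'"
    have "z' - z = 0"
      by (rule dense_imp_orthogonal_zero[of "dom N"])
        (use N z z' in \<open>auto simp: densely_defined_def cinner_diff_right\<close>)
    then show "z' = z" by simp
  qed (use z in blast)
  then show "app (adjoint N) y = z" by (simp add: app_def adjoint_def)
qed

lemma cinner_adjoint:
  assumes N: "densely_defined N" and x: "x \<in> dom N" and y: "y \<in> dom (adjoint N)"
  shows "cinner (app N x) y = cinner x (app (adjoint N) y)"
    and "cinner y (app N x) = cinner (app (adjoint N) y) x"
proof -
  obtain z where z: "\<And>x. x \<in> dom N \<Longrightarrow> cinner (app N x) y = cinner x z"
    using y unfolding adjoint_def dom_def by auto
  show "cinner (app N x) y = cinner x (app (adjoint N) y)"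
    using adjoint_eqI(2)[OF N z] z[OF x] by simp
  then show "cinner y (app N x) = cinner (app (adjoint N) y) x"
    by (metis cinner_commute)
qed

lemma linear_op_adjoint:
  assumes N: "densely_defined N"
  shows "linear_op (adjoint N)"
proof -
  have "0 \<in> dom (adjoint N)" by (rule adjoint_eqI(1)[OF N, of 0 0]) simp
  moreover have "x + y \<in> dom (adjoint N) \<and> app (adjoint N) (x + y) = app (adjoint N) x + app (adjoint N) y"
    if "x \<in> dom (adjoint N)" "y \<in> dom (adjoint N)" for x y
    using adjoint_eqI[OF N, of "x + y" "app (adjoint N) x + app (adjoint N) y"] that
    by (simp add: cinner_add_right cinner_adjoint[OF N])
  moreover have "c *\<^sub>C x \<in> dom (adjoint N) \<and> app (adjoint N) (c *\<^sub>C x) = c *\<^sub>C app (adjoint N) x"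
    if "x \<in> dom (adjoint N)" for x c
    using adjoint_eqI[OF N, of "c *\<^sub>C x" "c *\<^sub>C app (adjoint N) x"] that
    by (simp add: cinner_scaleC_right cinner_adjoint[OF N])
  ultimately show ?thesis unfolding linear_op_def by blast
qed

section \<open>The resolvent of a normal operator\<close>

locale normal_operator =
  fixes N :: "'a::complex_hilbert op"
  assumes normal: "normal_op N"
begin

abbreviation Ns where "Ns \<equiv> adjoint N"

lemma dense: "densely_defined N" and closed: "closed_op N" and linear: "linear_op N"
  using normal by (auto simp: normal_op_def closed_op_def)

lemmas linear_adjoint = linear_op_adjoint[OF dense]
lemmas adj = cinner_adjoint[OF dense]

lemma normal_dom:
  "x \<in> dom N \<and> app N x \<in> dom Ns \<longleftrightarrow> x \<in> dom Ns \<and> app Ns x \<in> dom N"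
proof -
  have "dom (op_comp N Ns) = dom (op_comp Ns N)"
    using normal by (simp add: normal_op_def op_eq_def)
  then show ?thesis by (auto simp: op_comp_def dom_def[of "(_, _)"])
qed

lemma normal_app:
  assumes "x \<in> dom N" "app N x \<in> dom Ns"
  shows "app N (app Ns x) = app Ns (app N x)"
proof -
  have "x \<in> dom (op_comp N Ns)"
    using assms normal_dom[of x] by (auto simp: op_comp_def dom_def[of "(_, _)"])
  then have "app (op_comp N Ns) x = app (op_comp Ns N) x"
    using normal by (simp add: normal_op_def op_eq_def)
  then show ?thesis by (simp add: op_comp_def app_def[of "(_, _)"])
qed

text \<open>Both squared norms equal \<open>cinner x (app Ns (app N x))\<close>, since
  \<open>N\<close> and \<open>Ns\<close> commute on such \<open>x\<close>.\<close>

lemma norm_adjoint_eq: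
  assumes "x \<in> dom N" "app N x \<in> dom Ns"
  shows "norm (app Ns x) = norm (app N x)"
proof -
  have "cinner (app N x) (app N x) = cinner (app Ns x) (app Ns x)"
    using assms normal_dom[of x] by (metis adj normal_app)
  then show ?thesis by (metis power2_norm_eq_cinner norm_ge_zero power2_eq_iff_nonneg)
qed

text \<open>Solving \<open>x + N* N x = u\<close> is projecting \<open>(u, 0)\<close> onto the graph of \<open>N\<close>.\<close>

lemma resolvent_exists: "\<exists>x. x \<in> dom N \<and> app N x \<in> dom Ns \<and> x + app Ns (app N x) = u"
proof -
  obtain p where p: "p \<in> graph N" "\<And>q. q \<in> graph N \<Longrightarrow> cinner ((u, 0) - p) q = 0"
    using orthogonal_projection_exists[OF csubspace_graph[OF linear], of "(u, 0)"] closed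
    unfolding closed_op_def by metis
  then obtain x where x: "x \<in> dom N" "p = (x, app N x)" by (auto simp: graph_def)
  have "cinner (app N v) (app N x) = cinner v (u - x)" if "v \<in> dom N" for v
  proof -
    \<comment> \<open>Orthogonality of \<open>(u - x, - app N x)\<close> to the graph says that
      \<open>app N x\<close> lies in \<open>dom Ns\<close> with image \<open>u - x\<close>.\<close>
    have "cinner (u - x) v + cinner (- app N x) (app N v) = 0"
      using p(2)[of "(v, app N v)"] that x by (auto simp: graph_def cinner_prod_def)
    then have "cinner (app N x) (app N v) = cinner (u - x) v" by (simp add: cinner_minus_left)
    then show ?thesis by (metis cinner_commute)
  qed
  from adjoint_eqI[OF dense this] x(1) show ?thesis by auto
qed

definition B where "B u = (SOME x. x \<in> dom N \<and> app N x \<in> dom Ns \<and> x + app Ns (app N x) = u)"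

lemma B_props: "B u \<in> dom N" "app N (B u) \<in> dom Ns" "B u + app Ns (app N (B u)) = u"
  using someI_ex[OF resolvent_exists[of u]] by (auto simp: B_def)

lemma B_props': "B u \<in> dom Ns" "app Ns (B u) \<in> dom N" "app N (app Ns (B u)) = u - B u"
  "app Ns (app N (B u)) = u - B u"
  using B_props[of u] normal_dom[of "B u"] normal_app[of "B u"] by (auto simp: algebra_simps)

text \<open>\<open>1 + N* N\<close> is injective: pairing \<open>d + N* N d\<close> with
  \<open>d\<close> gives the sum of the squared norms of \<open>d\<close> and \<open>N d\<close>.
  Algebraic identities for \<open>B\<close> are proved through this uniqueness.\<close>

lemma B_eqI:
  assumes "x \<in> dom N" "app N x \<in> dom Ns" "x + app Ns (app N x) = u"
  shows "B u = x"
proof -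
  define d where "d = B u - x"
  have d: "d \<in> dom N" "app N d \<in> dom Ns" "app N d = app N (B u) - app N x"
    unfolding d_def using assms B_props[of u] by (auto simp: linear_op_diff[OF linear] linear_op_diff[OF linear_adjoint])
  have "d + app Ns (app N d) = (B u + app Ns (app N (B u))) - (x + app Ns (app N x))"
    using assms(2) B_props(2)[of u] by (simp add: d(3) linear_op_diff[OF linear_adjoint]) (simp add: d_def)
  then have "d + app Ns (app N d) = 0" using assms(3) B_props(3)[of u] by simp
  then have "cinner d d + cinner (app N d) (app N d) = 0"
    using adj(1)[OF d(1,2)] by (metis cinner_add_right cinner_zero_right)
  then have "(norm d)\<^sup>2 + (norm (app N d))\<^sup>2 = 0"
    by (simp only: cinner_self_norm flip: of_real_add) (simp only: of_real_eq_0_iff)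
  then show ?thesis by (simp add: d_def sum_power2_eq_zero_iff)
qed

lemma B_add: "B (u + v) = B u + B v"
proof (rule B_eqI)
  have N: "app N (B u + B v) = app N (B u) + app N (B v)"
    using B_props by (simp add: linear_op_add[OF linear])
  show "B u + B v \<in> dom N" "app N (B u + B v) \<in> dom Ns"
    unfolding N using B_props by (simp_all add: linear_op_add[OF linear] linear_op_add[OF linear_adjoint])
  have "B u + B v + app Ns (app N (B u + B v))
      = (B u + app Ns (app N (B u))) + (B v + app Ns (app N (B v)))"
    unfolding N using B_props(1,2) by (simp add: linear_op_add[OF linear_adjoint])
  also have "\<dots> = u + v" by (simp only: B_props(3))
  finally show "B u + B v + app Ns (app N (B u + B v)) = u + v" .
qed

lemma B_scaleC: "B (c *\<^sub>C u) = c *\<^sub>C B u"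
proof (rule B_eqI)
  have N: "app N (c *\<^sub>C B u) = c *\<^sub>C app N (B u)"
    using B_props by (simp add: linear_op_scaleC[OF linear])
  show "c *\<^sub>C B u \<in> dom N" "app N (c *\<^sub>C B u) \<in> dom Ns"
    unfolding N using B_props by (simp_all add: linear_op_scaleC[OF linear] linear_op_scaleC[OF linear_adjoint])
  show "c *\<^sub>C B u + app Ns (app N (c *\<^sub>C B u)) = c *\<^sub>C u"
    unfolding N using B_props(2)[of u] B_props(3)[of u]
    by (metis linear_op_scaleC(2)[OF linear_adjoint] scaleC_add_right)
qed

text \<open>Splitting \<open>v\<close> into \<open>B v + N* N B v\<close> gives a hermitian
  expression, from which self-adjointness, positivity and norm bounds of \<open>B\<close> are read
  off.\<close>

lemma cinner_B: "cinner (B u) v = cinner (B u) (B v) + cinner (app N (B u)) (app N (B v))"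
  using B_props(3)[of v] adj(1)[OF B_props(1,2), of u v] by (metis cinner_add_right)

lemma B_selfadjoint: "cinner (B u) v = cinner u (B v)"
  by (metis (no_types, lifting) cinner_B cinner_commute complex_cnj_add)

lemma Re_cinner_B: "Re (cinner (B u) u) = (norm (B u))\<^sup>2 + (norm (app N (B u)))\<^sup>2"
  using cinner_B[of u u] by (simp add: power2_norm_eq_cinner)

lemma norm_B_le: "norm (B u) \<le> norm u"
proof (rule norm_le_of_sq_le_mult)
  show "(norm (B u))\<^sup>2 \<le> norm (B u) * norm u"
    using Re_cinner_B[of u] Re_cinner_le[of "B u" u] zero_le_power2[of "norm (app N (B u))"] by linarith
qed simp

lemma Re_cinner_B_le: "Re (cinner (B u) u) \<le> (norm u)\<^sup>2"
  using Re_cinner_le[of "B u" u] mult_right_mono[OF norm_B_le[of u], of "norm u"]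
  by (simp add: power2_eq_square)

lemma norm_adjoint_B: "norm (app Ns (B u)) = norm (app N (B u))"
  by (rule norm_adjoint_eq) (use B_props in auto)

lemma norm_N_B_le: "norm (app N (B u)) \<le> norm u"
proof -
  have "(norm (app N (B u)))\<^sup>2 \<le> (norm u)\<^sup>2"
    using Re_cinner_B[of u] Re_cinner_B_le[of u] zero_le_power2[of "norm (B u)"] by linarith
  then show ?thesis by simp
qed

lemma N_B: "u \<in> dom N \<Longrightarrow> app N (B u) = B (app N u)"
proof (rule B_eqI[symmetric])
  assume u: "u \<in> dom N"
  \<comment> \<open>This vector is \<open>N* N B u\<close>. The equality of domains in normality,
    applied to \<open>N B u\<close>, then puts \<open>N B u\<close> into the domain of
    \<open>N* N\<close>.\<close>
  have d: "u - B u \<in> dom N" using u B_props by (simp add: linear_op_diff[OF linear])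
  with B_props(2)[of u] B_props'(4)[of u]
  show 1: "app N (B u) \<in> dom N" "app N (app N (B u)) \<in> dom Ns"
    using normal_dom[of "app N (B u)"] by auto
  have "app Ns (app N (app N (B u))) = app N (u - B u)"
    using normal_app[OF 1] by (simp add: B_props')
  then show "app N (B u) + app Ns (app N (app N (B u))) = app N u"
    using u B_props by (simp add: linear_op_diff[OF linear])
qed

lemma Ns_B: "u \<in> dom Ns \<Longrightarrow> app Ns (B u) = B (app Ns u)"
  by (rule B_eqI[symmetric]) (use B_props in \<open>simp_all add: B_props' linear_op_diff[OF linear_adjoint]\<close>)

text \<open>Splitting \<open>y\<close> into \<open>B y + N N* B y\<close> lets each operator be
  moved across the inner product within its domain.\<close>

lemma cinner_N_B: "cinner (app N (B x)) y = cinner x (app Ns (B y))"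
proof -
  have "cinner (app N (B x)) y = cinner (app N (B x)) (B y) + cinner (app N (B x)) (app N (app Ns (B y)))"
    by (simp add: B_props' flip: cinner_add_right)
  also have "\<dots> = cinner (B x + app Ns (app N (B x))) (app Ns (B y))"
    by (simp add: adj B_props(1,2) B_props'(1,2) cinner_add_left)
  finally show ?thesis by (simp only: B_props(3))
qed

lemma bounded_linear_B: "bounded_linear B"
  and bounded_linear_N_B: "bounded_linear (\<lambda>x. app N (B x))"
  and bounded_linear_Ns_B: "bounded_linear (\<lambda>x. app Ns (B x))"
proof -
  note l = B_add B_scaleC scaleR_scaleC linear_op_add[OF linear] linear_op_scaleC[OF linear]
    linear_op_add[OF linear_adjoint] linear_op_scaleC[OF linear_adjoint] B_props B_props'
  show "bounded_linear B"
    by (rule bounded_linear_intro[of _ 1]) (auto simp: l norm_B_le)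
  show "bounded_linear (\<lambda>x. app N (B x))"
    by (rule bounded_linear_intro[of _ 1]) (auto simp: l norm_N_B_le)
  show "bounded_linear (\<lambda>x. app Ns (B x))"
    by (rule bounded_linear_intro[of _ 1]) (auto simp: l norm_N_B_le norm_adjoint_B)
qed

text \<open>\<open>cutoff K r\<close> abstracts from the range \<open>K\<close> of the spectral projection of \<open>N\<close> onto a
  bounded set.\<close>

definition cutoff :: "'a set \<Rightarrow> real \<Rightarrow> bool" where
  "cutoff K r \<longleftrightarrow> csubspace K \<and> closed K \<and> 0 \<le> r \<and>
    (\<forall>x\<in>K. x \<in> dom N \<and> x \<in> dom Ns \<and> app N x \<in> K \<and> app Ns x \<in> K \<and> norm (app N x) \<le> r * norm x) \<and>
    (\<forall>x\<in>dom N. app N (proj K x) = proj K (app N x))"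

text \<open>\<open>B - c\<close> is split by sign. On \<open>K\<close> the operator \<open>B\<close>
  is invertible, so \<open>N\<close>, being \<open>N B\<close> after the inverse of
  \<open>B\<close>, has norm at most \<open>1 / c\<close>; on the complement \<open>B\<close> and
  \<open>N B\<close> have norm at most \<open>sqrt c\<close>.\<close>

lemma spectral_cutoff:
  assumes c: "0 < c" "c \<le> 1/2"
  obtains K where "cutoff K (1 / c)"
    "\<And>x. x \<in> dom N \<Longrightarrow> norm (x - proj K x) \<le> sqrt c * (norm x + norm (app N x))"
proof -
  define Bb where "Bb = Blinfun B"
  have Bb: "blinfun_apply Bb x = B x" for x
    by (simp add: Bb_def bounded_linear_Blinfun_apply bounded_linear_B)
  define S where "S = Bb - c *\<^sub>R id_blinfun"
  have Sx: "S x = B x - c *\<^sub>R x" for x by (simp add: S_def blinfun.diff_left blinfun.scaleR_left Bb)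
  have "norm S \<le> 1"
  proof (rule norm_blinfun_bound)
    fix x
    have "(norm (S x))\<^sup>2 = (norm (B x))\<^sup>2 - 2 * c * Re (cinner (B x) x) + c\<^sup>2 * (norm x)\<^sup>2"
      unfolding Sx norm_diff_sq by (simp add: cinner_simps power_mult_distrib)
    also have "\<dots> \<le> (1 - 2 * c) * Re (cinner (B x) x) + c\<^sup>2 * (norm x)\<^sup>2"
      using Re_cinner_B[of x] by (simp add: algebra_simps)
    \<comment> \<open>Here \<open>c \<le> 1/2\<close> keeps the coefficient \<open>1 - 2 * c\<close>
      nonnegative.\<close>
    also have "\<dots> \<le> (1 - 2 * c) * (norm x)\<^sup>2 + c\<^sup>2 * (norm x)\<^sup>2"
      using c Re_cinner_B_le[of x] by (intro add_right_mono mult_left_mono) auto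
    also have "\<dots> = (1 - c)\<^sup>2 * (norm x)\<^sup>2" by (simp add: power2_diff algebra_simps)
    also have "\<dots> \<le> 1 * (norm x)\<^sup>2"
      using c by (intro mult_right_mono power_le_one) auto
    finally show "norm (S x) \<le> 1 * norm x" by simp
  qed simp
  moreover have "cinner (S x) y = cinner x (S y)" for x y
    by (simp add: Sx cinner_simps B_selfadjoint)
  ultimately obtain K where K: "csubspace K" "closed K"
    and inv: "\<And>(D :: 'a \<Rightarrow>\<^sub>L 'a) x. D o\<^sub>L S = S o\<^sub>L D \<Longrightarrow> x \<in> K \<Longrightarrow> D x \<in> K"
    and pos: "\<And>x. x \<in> K \<Longrightarrow> 0 \<le> Re (cinner (S x) x)"
    and neg: "\<And>x. (\<And>k. k \<in> K \<Longrightarrow> cinner x k = 0) \<Longrightarrow> Re (cinner (S x) x) \<le> 0"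
    by (rule spectral_splitting) blast
  have ReS: "Re (cinner (S x) x) = Re (cinner (B x) x) - c * (norm x)\<^sup>2" for x
    by (simp add: Sx cinner_simps power2_norm_eq_cinner)
  have inv': "f x \<in> K" if "bounded_linear f" "\<And>x. f (B x) = B (f x)" "x \<in> K" for f x
  proof -
    have f: "blinfun_apply (Blinfun f) x = f x" for x
      using that(1) by (simp add: bounded_linear_Blinfun_apply)
    have "Blinfun f o\<^sub>L S = S o\<^sub>L Blinfun f"
      by (rule blinfun_eqI)
        (simp add: f Sx that(2) linear_diff[OF bounded_linear.linear[OF that(1)]]
          linear_scale[OF bounded_linear.linear[OF that(1)]])
    from inv[OF this that(3)] show ?thesis by (simp add: f)
  qed
  have BK: "B x \<in> K" and NBK: "app N (B x) \<in> K" and NsBK: "app Ns (B x) \<in> K" if "x \<in> K" for x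
    using that by (auto intro!: inv'[where f = B] inv'[where f = "\<lambda>x. app N (B x)"]
        inv'[where f = "\<lambda>x. app Ns (B x)"] bounded_linear_B bounded_linear_N_B bounded_linear_Ns_B
        simp: N_B Ns_B B_props B_props'(1))
  have lower: "c * (norm x)\<^sup>2 \<le> Re (cinner (B x) x)" if "x \<in> K" for x
    using pos[OF that] by (simp add: ReS)
  have upper: "Re (cinner (B x) x) \<le> c * (norm x)\<^sup>2" if "\<And>k. k \<in> K \<Longrightarrow> cinner x k = 0" for x
    using neg[OF that] by (simp add: ReS)
  have surj: "\<exists>u\<in>K. B u = x" if x: "x \<in> K" for x
  proof -
    have B_diff: "B (u - v) = B u - B v" for u v
      by (rule linear_diff[OF bounded_linear.linear[OF bounded_linear_B]])
    \<comment> \<open>A fixed point satisfies \<open>B u = x\<close>. The map contracts on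
      \<open>K\<close> because \<open>B\<close> is at least \<open>c\<close> there and the squared
      norm of \<open>B d\<close> is at most \<open>Re (cinner (B d) d)\<close>.\<close>
    have "\<exists>!u. u \<in> K \<and> x + (u - B u) = u"
    proof (rule Banach_fix)
      show "complete K" using K(2) by (simp add: complete_eq_closed)
      show "K \<noteq> {}" using x by blast
      show "0 \<le> sqrt (1 - c)" "sqrt (1 - c) < 1" using c by auto
      show "(\<lambda>u. x + (u - B u)) ` K \<subseteq> K"
        using x K(1) BK csubspace_diff[OF K(1)] by (auto simp: csubspace_def)
      show "dist (x + (u - B u)) (x + (v - B v)) \<le> sqrt (1 - c) * dist u v" if "u \<in> K" "v \<in> K" for u v
      proof -
        define d where "d = u - v"
        have d: "d \<in> K" unfolding d_def using that csubspace_diff[OF K(1)] by blast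
        have "(norm (d - B d))\<^sup>2 = (norm d)\<^sup>2 - 2 * Re (cinner (B d) d) + (norm (B d))\<^sup>2"
          by (simp add: norm_diff_sq Re_cinner_commute[of d])
        also have "\<dots> \<le> (norm d)\<^sup>2 - Re (cinner (B d) d)"
          using Re_cinner_B[of d] by simp
        also have "\<dots> \<le> (1 - c) * (norm d)\<^sup>2" using lower[OF d] by (simp add: algebra_simps)
        also have "\<dots> = (sqrt (1 - c) * norm d)\<^sup>2" using c by (simp add: power_mult_distrib)
        finally have "norm (d - B d) \<le> sqrt (1 - c) * norm d"
          by (rule power2_le_imp_le) (use c in simp)
        moreover have "(x + (u - B u)) - (x + (v - B v)) = d - B d" by (simp add: d_def B_diff)
        ultimately show ?thesis unfolding dist_norm d_def[symmetric] by (simp only:)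
      qed
    qed
    then obtain u where "u \<in> K" "x + (u - B u) = u" by blast
    then show ?thesis by (intro bexI[of _ u]) (auto simp: algebra_simps)
  qed
  have Kprops: "x \<in> dom N \<and> x \<in> dom Ns \<and> app N x \<in> K \<and> app Ns x \<in> K \<and> norm (app N x) \<le> 1 / c * norm x"
    if x: "x \<in> K" for x
  proof -
    obtain u where u: "u \<in> K" "B u = x" using surj[OF x] by blast
    have "c * norm u \<le> norm x"
    proof (cases "u = 0")
      case False
      have "c * norm u * norm u \<le> norm x * norm u"
        using lower[OF u(1)] Re_cinner_le[of "B u" u] u(2) by (simp add: power2_eq_square mult.assoc)
      then show ?thesis using False by simp
    qed simp
    then have "norm u \<le> 1 / c * norm x" using c by (simp add: field_simps)
    then have "norm (app N x) \<le> 1 / c * norm x" using norm_N_B_le[of u] u(2) by simp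
    with NBK[OF u(1)] NsBK[OF u(1)] B_props[of u] B_props'[of u] u(2) show ?thesis by auto
  qed
  have PB: "proj K (B x) = B (proj K x)" for x
    by (rule proj_commute[OF K linear_diff[OF bounded_linear.linear[OF bounded_linear_B]] B_selfadjoint BK BK])
  have PNB: "proj K (app N (B x)) = app N (B (proj K x))" for x
    by (rule proj_commute[OF K linear_diff[OF bounded_linear.linear[OF bounded_linear_N_B]] cinner_N_B NBK NsBK])
  have PN: "app N (proj K x) = proj K (app N x)" if x: "x \<in> dom N" for x
  proof -
    have Px: "proj K x \<in> dom N" using Kprops proj_in[OF K] by blast
    \<comment> \<open>The identity is first shown after applying \<open>B\<close>, which turns
      \<open>N\<close> into the bounded \<open>N B\<close>; \<open>B\<close> is injective by its
      defining equation.\<close>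
    have "B (app N (proj K x)) = app N (B (proj K x))" using N_B[OF Px] by simp
    also have "\<dots> = proj K (app N (B x))" by (simp add: PNB)
    also have "\<dots> = B (proj K (app N x))" by (simp add: N_B[OF x] PB)
    finally have "B (app N (proj K x)) = B (proj K (app N x))" .
    then show ?thesis by (metis B_props(3))
  qed
  have approx: "norm (x - proj K x) \<le> sqrt c * (norm x + norm (app N x))" if x: "x \<in> dom N" for x
  proof -
    define y where "y = x - proj K x"
    define w where "w = app N x - proj K (app N x)"
    have Px: "proj K x \<in> dom N" using Kprops proj_in[OF K] by blast
    have y: "y \<in> dom N" "app N y = w"
      using x Px by (simp_all add: y_def w_def PN linear_op_diff[OF linear])
    have perp: "cinner y k = 0" "cinner w k = 0" if "k \<in> K" for k
      using that proj_ortho[OF K] by (simp_all add: y_def w_def)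
    have sq: "a \<le> sqrt c * b" if "a\<^sup>2 \<le> c * b\<^sup>2" "0 \<le> b" for a b
      by (rule power2_le_imp_le) (use that c in \<open>simp_all add: power_mult_distrib\<close>)
    have "norm (B y) \<le> sqrt c * norm y"
      by (rule sq) (use Re_cinner_B[of y] upper[OF perp(1)] zero_le_power2[of "norm (app N (B y))"] in \<open>simp_all, linarith\<close>)
    moreover have "norm (app Ns (B w)) \<le> sqrt c * norm w"
      unfolding norm_adjoint_B
      by (rule sq) (use Re_cinner_B[of w] upper[OF perp(2)] zero_le_power2[of "norm (B w)"] in \<open>simp_all, linarith\<close>)
    \<comment> \<open>The resolvent equation for \<open>y\<close>, with \<open>N B y = B w\<close>,
      splits \<open>y\<close> into two terms that are small off \<open>K\<close>.\<close>
    moreover have "y = B y + app Ns (B w)"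
      using B_props(3)[of y] N_B[OF y(1)] y(2) by simp
    then have "norm y \<le> norm (B y) + norm (app Ns (B w))" by (metis norm_triangle_ineq)
    moreover have "sqrt c * norm y \<le> sqrt c * norm x" "sqrt c * norm w \<le> sqrt c * norm (app N x)"
      unfolding y_def w_def using c by (intro mult_left_mono norm_diff_proj_le K; simp)+
    ultimately show ?thesis unfolding y_def[symmetric] distrib_left by linarith
  qed
  have "cutoff K (1 / c)"
    unfolding cutoff_def using K Kprops PN c by auto
  then show ?thesis using that approx by blast
qed

end

section \<open>The unbounded theorem\<close>

context normal_operator
begin

section \<open>Approximation by cut-offs\<close>

lemma
  assumes "cutoff K r"
  shows cutoff_csubspace: "csubspace K" "closed K" and cutoff_nonneg: "0 \<le> r"
    and cutoff_dom: "x \<in> K \<Longrightarrow> x \<in> dom N" "x \<in> K \<Longrightarrow> x \<in> dom Ns"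
    and cutoff_invariant: "x \<in> K \<Longrightarrow> app N x \<in> K" "x \<in> K \<Longrightarrow> app Ns x \<in> K"
    and cutoff_bound: "x \<in> K \<Longrightarrow> norm (app N x) \<le> r * norm x"
    and cutoff_commute: "x \<in> dom N \<Longrightarrow> app N (proj K x) = proj K (app N x)"
  using assms unfolding cutoff_def by blast+

lemma cutoff_commute_adjoint:
  assumes K: "cutoff K r" and x: "x \<in> dom Ns"
  shows "app Ns (proj K x) = proj K (app Ns x)"
proof (rule adjoint_eqI(2)[OF dense])
  fix v assume v: "v \<in> dom N"
  note sub = cutoff_csubspace[OF K]
  have "cinner (app N v) (proj K x) = cinner (app N (proj K v)) x"
    by (simp add: cutoff_commute[OF K v] cinner_proj_left[OF sub])
  also have "\<dots> = cinner v (proj K (app Ns x))"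
    using adj(1)[OF cutoff_dom(1)[OF K proj_in[OF sub]] x] by (simp add: cinner_proj_left[OF sub])
  finally show "cinner (app N v) (proj K x) = cinner v (proj K (app Ns x))" .
qed

text \<open>The bound \<open>s\<close> may exceed \<open>r\<close>, so that two cut-offs can share
  one bound.\<close>

lemma bounded_normal_cutoff:
  assumes K: "cutoff K r" and s: "r \<le> s"
  shows "bounded_normal (\<lambda>x. app N (proj K x)) (\<lambda>x. app Ns (proj K x)) s"
proof
  note sub = cutoff_csubspace[OF K]
  note P = proj_in[OF sub]
  note D = cutoff_dom[OF K P] cutoff_invariant[OF K P]
  show "clinear (\<lambda>x. app N (proj K x))" "clinear (\<lambda>x. app Ns (proj K x))"
    by (auto simp: clinear_def proj_add[OF sub] proj_scaleC[OF sub] D linear_op_add[OF linear]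
        linear_op_scaleC[OF linear] linear_op_add[OF linear_adjoint] linear_op_scaleC[OF linear_adjoint])
  show s0: "0 \<le> s" using s cutoff_nonneg[OF K] by simp
  have bound: "norm (app N (proj K x)) \<le> s * norm x" for x
  proof -
    have "norm (app N (proj K x)) \<le> r * norm (proj K x)" by (rule cutoff_bound[OF K P])
    also have "\<dots> \<le> s * norm x"
      using s s0 by (intro mult_mono norm_proj_le sub) auto
    finally show ?thesis .
  qed
  fix x y
  show "norm (app N (proj K x)) \<le> s * norm x" by (rule bound)
  show "norm (app Ns (proj K x)) \<le> s * norm x"
    using bound[of x] norm_adjoint_eq[of "proj K x"] D cutoff_dom[OF K] by simp
  show "cinner (app N (proj K x)) y = cinner x (app Ns (proj K y))"
  proof -
    have "cinner (app N (proj K x)) y = cinner (app N (proj K x)) (proj K y)"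
      using cinner_proj_left[OF sub, of "app N (proj K x)" y] by (simp add: proj_id[OF sub] D)
    also have "\<dots> = cinner x (app Ns (proj K y))"
      using cinner_proj_left[OF sub, of x "app Ns (proj K y)"] by (simp add: adj D proj_id[OF sub])
    finally show ?thesis .
  qed
  show "app N (proj K (app Ns (proj K x))) = app Ns (proj K (app N (proj K x)))"
    using D cutoff_dom[OF K] by (simp add: proj_id[OF sub] normal_app)
qed

text \<open>Convergence holds on the dense \<open>dom N\<close> by the estimate of
  \<open>spectral_cutoff\<close> and extends because the complementary projections are
  contractions.\<close>

lemma approximating_cutoffs:
  obtains K r where "\<And>k::nat. cutoff (K k) (r k)" "\<And>x. (\<lambda>k. proj (K k) x) \<longlonglongrightarrow> x"
proof -
  \<comment> \<open>The double successor ensures \<open>c k \<le> 1/2\<close>.\<close>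
  define c where "c k = 1 / real (Suc (Suc k))" for k
  have c: "0 < c k" "c k \<le> 1/2" for k by (simp_all add: c_def)
  have "\<exists>K. cutoff K (1 / c k) \<and>
      (\<forall>x\<in>dom N. norm (x - proj K x) \<le> sqrt (c k) * (norm x + norm (app N x)))" for k
    using spectral_cutoff[OF c] by metis
  then obtain K where K: "\<And>k. cutoff (K k) (1 / c k)"
    and approx: "\<And>k x. x \<in> dom N \<Longrightarrow> norm (x - proj (K k) x) \<le> sqrt (c k) * (norm x + norm (app N x))"
    by metis
  have "c \<longlonglongrightarrow> 0"
    unfolding c_def using LIMSEQ_Suc[OF LIMSEQ_Suc[OF lim_1_over_n]] by simp
  then have sc: "(\<lambda>k. sqrt (c k)) \<longlonglongrightarrow> 0" using tendsto_real_sqrt by fastforce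
  have "(\<lambda>k. proj (K k) x) \<longlonglongrightarrow> x" for x
  proof (rule LIMSEQ_I)
    fix e :: real assume e: "e > 0"
    have "x \<in> closure (dom N)" using dense by (simp add: densely_defined_def)
    then obtain v where v: "v \<in> dom N" "dist v x < e/2"
      using e unfolding closure_approachable by (metis half_gt_zero)
    have "(\<lambda>k. sqrt (c k) * (norm v + norm (app N v))) \<longlonglongrightarrow> 0 * (norm v + norm (app N v))"
      by (intro tendsto_intros sc)
    from order_tendstoD(2)[OF this, of "e/2"] e
    obtain n where n: "\<And>k. k \<ge> n \<Longrightarrow> sqrt (c k) * (norm v + norm (app N v)) < e/2"
      unfolding eventually_sequentially by auto
    have "norm (proj (K k) x - x) < e" if "k \<ge> n" for k
    proof -
      note sub = cutoff_csubspace[OF K[of k]]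
      have "x - proj (K k) x = ((x - v) - proj (K k) (x - v)) + (v - proj (K k) v)"
        by (simp add: proj_diff[OF sub])
      then have "norm (x - proj (K k) x) \<le> norm ((x - v) - proj (K k) (x - v)) + norm (v - proj (K k) v)"
        by (metis norm_triangle_ineq)
      also have "\<dots> < e/2 + e/2"
        using norm_diff_proj_le[OF sub, of "x - v"] approx[OF v(1), of k] n[OF that] v(2)
        by (simp add: dist_norm norm_minus_commute)
      finally show ?thesis by (simp add: norm_minus_commute)
    qed
    then show "\<exists>no. \<forall>n\<ge>no. norm (proj (K n) x - x) < e" by blast
  qed
  then show ?thesis by (rule that[of K "\<lambda>k. 1 / c k", OF K])
qed

text \<open>On cut-offs \<open>N\<close> and \<open>Ns\<close> have equal norms, so convergence of
  the \<open>Ns\<close> values makes the \<open>N\<close> values Cauchy, and closedness of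
  \<open>N\<close> admits the limit.\<close>

lemma dom_adjoint_subset: "dom Ns \<subseteq> dom N"
proof
  fix x assume x: "x \<in> dom Ns"
  obtain K r where K: "\<And>k::nat. cutoff (K k) (r k)" and lim: "\<And>x. (\<lambda>k. proj (K k) x) \<longlonglongrightarrow> x"
    by (rule approximating_cutoffs) blast
  let ?P = "\<lambda>k. proj (K k) x"
  have P: "?P k \<in> K k" for k using proj_in cutoff_csubspace[OF K] by blast
  have D: "?P k \<in> dom N" "?P k \<in> dom Ns" "app N (?P k) \<in> dom Ns" for k
    using P cutoff_dom[OF K] cutoff_invariant[OF K] by blast+
  have same: "norm (app N (?P j) - app N (?P k)) = norm (app Ns (?P j) - app Ns (?P k))" for j k
    using norm_adjoint_eq[of "?P j - ?P k"] D
    by (simp add: linear_op_diff[OF linear] linear_op_diff[OF linear_adjoint])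
  have "(\<lambda>k. app Ns (?P k)) \<longlonglongrightarrow> app Ns x"
    using lim[of "app Ns x"] by (simp add: cutoff_commute_adjoint[OF K x])
  then have "Cauchy (\<lambda>k. app Ns (?P k))" by (rule LIMSEQ_imp_Cauchy)
  then have "Cauchy (\<lambda>k. app N (?P k))" by (simp add: Cauchy_def dist_norm same)
  then obtain y where "(\<lambda>k. app N (?P k)) \<longlonglongrightarrow> y" using Cauchy_convergent convergent_def by blast
  from closed_op_limit(1)[OF closed D(1) lim this] show "x \<in> dom N" .
qed

end

section \<open>From cut-offs to the intertwiner T\<close>

locale intertwined = normal_operator N for N :: "'a::complex_hilbert op" +
  fixes T :: "'a op"
  assumes T: "closed_op T" and dom_subset: "dom N \<subseteq> dom T"
    and intertwine: "op_le (op_comp T N) (op_comp N T)"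
begin

lemma T_linear: "linear_op T" using T by (simp add: closed_op_def)

lemma T_N:
  assumes "x \<in> dom N" "app N x \<in> dom T"
  shows "app T x \<in> dom N" "app N (app T x) = app T (app N x)"
  using assms intertwine
  by (auto simp: op_le_def op_comp_def dom_def[of "(_, _)"] app_def[of "(_, _)"] subset_eq)

text \<open>Projecting both arguments makes \<open>\<phi>\<close> an everywhere defined bounded
  form, to which \<open>adjoint_intertwine\<close> applies.\<close>

lemma fuglede_cutoff:
  assumes K: "cutoff K r" and L: "cutoff L s" and x: "x \<in> K" and y: "y \<in> L"
  shows "cinner (app T (app Ns x)) y = cinner (app T x) (app N y)"
proof -
  note subK = cutoff_csubspace[OF K] and subL = cutoff_csubspace[OF L]
  note PK = proj_in[OF subK] and PL = proj_in[OF subL]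
  note DK = cutoff_dom[OF K PK] cutoff_invariant[OF K PK]
    and DL = cutoff_dom[OF L PL] cutoff_invariant[OF L PL]
  have DT: "z \<in> dom T" if "z \<in> K" for z using that cutoff_dom[OF K] dom_subset by blast
  obtain C where C: "C \<ge> 0" "\<And>x. x \<in> dom N \<Longrightarrow> norm (app T x) \<le> C * (norm x + norm (app N x))"
    using closed_op_relatively_bounded[OF T closed dom_subset] by blast
  define \<phi> where "\<phi> v w = cinner (app T (proj K v)) (proj L w)" for v w
  interpret V: bounded_normal "\<lambda>x. app N (proj K x)" "\<lambda>x. app Ns (proj K x)" "max r s"
    by (rule bounded_normal_cutoff[OF K]) simp
  interpret W: bounded_normal "\<lambda>x. app N (proj L x)" "\<lambda>x. app Ns (proj L x)" "max r s"
    by (rule bounded_normal_cutoff[OF L]) simp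
  interpret intertwining_form "\<lambda>x. app N (proj K x)" "\<lambda>x. app Ns (proj K x)"
    "\<lambda>x. app N (proj L x)" "\<lambda>x. app Ns (proj L x)" "max r s" \<phi> "C * (1 + r)"
  proof
    fix v w z c
    show "\<phi> (v + z) w = \<phi> v w + \<phi> z w"
      by (simp add: \<phi>_def proj_add[OF subK] linear_op_add[OF T_linear] DT PK cinner_simps)
    show "\<phi> (c *\<^sub>C v) w = cnj c * \<phi> v w"
      by (simp add: \<phi>_def proj_scaleC[OF subK] linear_op_scaleC[OF T_linear] DT PK cinner_simps)
    show "\<phi> v (z + w) = \<phi> v z + \<phi> v w"
      by (simp add: \<phi>_def proj_add[OF subL] cinner_simps)
    show "\<phi> v (c *\<^sub>C w) = c * \<phi> v w"
      by (simp add: \<phi>_def proj_scaleC[OF subL] cinner_simps)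
    show "0 \<le> C * (1 + r)" using C cutoff_nonneg[OF K] by simp
    \<comment> \<open>On \<open>K\<close> the operator \<open>N\<close> has bound \<open>r\<close>,
      so the relative bound of \<open>T\<close> becomes a genuine one.\<close>
    have "norm (app T (proj K v)) \<le> C * (norm (proj K v) + r * norm (proj K v))"
      using cutoff_bound[OF K PK] C(1) by (intro order.trans[OF C(2)[OF DK(1)]] mult_left_mono add_left_mono)
    also have "\<dots> = C * (1 + r) * norm (proj K v)" by (simp add: algebra_simps)
    also have "\<dots> \<le> C * (1 + r) * norm v"
      using C(1) cutoff_nonneg[OF K] by (intro mult_left_mono norm_proj_le subK) simp
    finally have "norm (app T (proj K v)) * norm (proj L w) \<le> C * (1 + r) * norm v * norm w"
      using C(1) cutoff_nonneg[OF K] by (intro mult_mono norm_proj_le subL) auto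
    then show "cmod (\<phi> v w) \<le> C * (1 + r) * norm v * norm w"
      unfolding \<phi>_def by (rule order.trans[OF norm_cinner_le])
    have "\<phi> (app N (proj K v)) w = cinner (app N (app T (proj K v))) (proj L w)"
      by (simp add: \<phi>_def proj_id[OF subK] DK T_N DT)
    also have "\<dots> = cinner (app T (proj K v)) (app Ns (proj L w))"
      by (rule adj(1)[OF T_N(1)[OF DK(1) DT[OF DK(3)]] DL(2)])
    also have "\<dots> = \<phi> v (app Ns (proj L w))"
      by (simp add: \<phi>_def proj_id[OF subL] DL)
    finally show "\<phi> (app N (proj K v)) w = \<phi> v (app Ns (proj L w))" .
  qed
  show ?thesis
    using adjoint_intertwine[of x y] x y cutoff_invariant[OF K] cutoff_invariant[OF L]
    by (simp add: \<phi>_def proj_id[OF subK] proj_id[OF subL])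
qed

theorem fuglede_unbounded:
  assumes x: "x \<in> dom Ns" and y: "app Ns x \<in> dom T"
  shows "app T x \<in> dom Ns" "app Ns (app T x) = app T (app Ns x)"
proof -
  define y where "y = app Ns x"
  define z where "z = app Ns (B y)"
  have xN: "x \<in> dom N" using x dom_adjoint_subset by blast
  have z: "z \<in> dom N" "app N z = y - B y" by (simp_all add: z_def B_props')
  have By: "B y \<in> dom N" "B y \<in> dom T" using B_props dom_subset by auto
  have yT: "y \<in> dom T" using y by (simp add: y_def)
  have Nz: "app N z \<in> dom T" using z yT By by (simp add: linear_op_diff[OF T_linear])
  \<comment> \<open>Moving \<open>T\<close> past \<open>N\<close> in \<open>y = B y + N z\<close>
    expresses \<open>T y\<close> through values of \<open>T\<close> at vectors of
    \<open>dom N\<close>.\<close>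
  have Ty: "app T y = app T (B y) + app N (app T z)"
    using T_N(2)[OF z(1) Nz] z(2) yT By by (simp add: linear_op_diff[OF T_linear])
  obtain C where C: "C \<ge> 0" "\<And>x. x \<in> dom N \<Longrightarrow> norm (app T x) \<le> C * (norm x + norm (app N x))"
    using closed_op_relatively_bounded[OF T closed dom_subset] by blast
  obtain K r where K: "\<And>k::nat. cutoff (K k) (r k)" and lim: "\<And>x. (\<lambda>k. proj (K k) x) \<longlonglongrightarrow> x"
    by (rule approximating_cutoffs) blast
  note sub = cutoff_csubspace[OF K]
  have D: "proj (K k) v \<in> dom N" "proj (K k) v \<in> dom T" for k v
    using proj_in[OF sub] cutoff_dom(1)[OF K] dom_subset by blast+
  \<comment> \<open>\<open>N\<close> commutes with the projections, so they converge in the graph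
    norm of \<open>N\<close>, which dominates \<open>T\<close>.\<close>
  have limT: "(\<lambda>k. app T (proj (K k) v)) \<longlonglongrightarrow> app T v" if v: "v \<in> dom N" for v
  proof -
    have le: "norm (app T (proj (K k) v) - app T v)
        \<le> C * (norm (proj (K k) v - v) + norm (proj (K k) (app N v) - app N v))" for k
      using C(2)[of "proj (K k) v - v"] v D dom_subset
      by (simp add: linear_op_diff[OF linear] linear_op_diff[OF T_linear] subset_eq cutoff_commute[OF K v])
    have "(\<lambda>k. C * (norm (proj (K k) v - v) + norm (proj (K k) (app N v) - app N v)))
        \<longlonglongrightarrow> C * (norm (v - v) + norm (app N v - app N v))"
      by (intro tendsto_intros lim)
    then have "(\<lambda>k. C * (norm (proj (K k) v - v) + norm (proj (K k) (app N v) - app N v))) \<longlonglongrightarrow> 0"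
      by simp
    then have "(\<lambda>k. app T (proj (K k) v) - app T v) \<longlonglongrightarrow> 0"
      by (rule Lim_null_comparison[OF always_eventually[OF allI[OF le]]])
    then show ?thesis by (simp add: LIM_zero_iff)
  qed
  \<comment> \<open>With \<open>u\<close> in a cut-off, \<open>N\<close> and \<open>Ns\<close> can
    act on \<open>u\<close>. Then \<open>T\<close> meets only projections of \<open>B y\<close>,
    \<open>z\<close> and \<open>x\<close>, all in \<open>dom N\<close>, so \<open>limT\<close>
    applies.\<close>
  have core: "cinner (app N u) (app T x) = cinner u (app T y)" if u: "u \<in> K j" for u j
  proof -
    have "cinner (app T (proj (K k) (B y))) u + cinner (app T (proj (K k) z)) (app Ns u)
        = cinner (app T (proj (K k) x)) (app N u)" for k
    proof -
      let ?P = "proj (K k)"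
      note PK = proj_in[OF sub, of k]
      have NPz: "app N (?P z) \<in> dom T" using cutoff_invariant(1)[OF K PK] cutoff_dom(1)[OF K] dom_subset by blast
      have "cinner (app T (?P z)) (app Ns u) = cinner (app T (app N (?P z))) u"
        using adj(1)[OF T_N(1)[OF D(1) NPz] cutoff_dom(2)[OF K u]] T_N(2)[OF D(1) NPz] by simp
      also have "app N (?P z) = ?P y - ?P (B y)"
        by (simp add: cutoff_commute[OF K z(1)] z(2) proj_diff[OF sub])
      finally have "cinner (app T (?P (B y))) u + cinner (app T (?P z)) (app Ns u) = cinner (app T (?P y)) u"
        by (simp add: linear_op_diff[OF T_linear] D cinner_diff_left)
      also have "?P y = app Ns (?P x)" by (simp add: y_def cutoff_commute_adjoint[OF K x])
      also have "cinner (app T (app Ns (?P x))) u = cinner (app T (?P x)) (app N u)"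
        by (rule fuglede_cutoff[OF K K PK u])
      finally show ?thesis .
    qed
    moreover have "(\<lambda>k. cinner (app T (proj (K k) (B y))) u + cinner (app T (proj (K k) z)) (app Ns u))
        \<longlonglongrightarrow> cinner (app T (B y)) u + cinner (app T z) (app Ns u)"
      by (intro tendsto_intros tendsto_cinner limT By z(1))
    moreover have "(\<lambda>k. cinner (app T (proj (K k) x)) (app N u)) \<longlonglongrightarrow> cinner (app T x) (app N u)"
      by (intro tendsto_cinner limT xN tendsto_const)
    ultimately have "cinner (app T (B y)) u + cinner (app T z) (app Ns u) = cinner (app T x) (app N u)"
      using LIMSEQ_unique by simp
    moreover have "cinner (app T z) (app Ns u) = cinner (app N (app T z)) u"
      by (rule adj(1)[OF T_N(1)[OF z(1) Nz] cutoff_dom(2)[OF K u], symmetric])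
    ultimately have "cinner (app T y) u = cinner (app T x) (app N u)"
      by (simp add: Ty cinner_add_left)
    then show ?thesis by (metis cinner_commute)
  qed
  \<comment> \<open>\<open>core\<close> is applied to the projections of \<open>u\<close>; since
    \<open>N\<close> commutes with them, both sides converge.\<close>
  have "cinner (app N u) (app T x) = cinner u (app T y)" if u: "u \<in> dom N" for u
  proof (rule LIMSEQ_unique)
    show "(\<lambda>k. cinner (proj (K k) u) (app T y)) \<longlonglongrightarrow> cinner u (app T y)"
      by (intro tendsto_cinner lim tendsto_const)
    have "cinner (proj (K k) u) (app T y) = cinner (proj (K k) (app N u)) (app T x)" for k
      using core[OF proj_in[OF sub[of k]], of u] by (simp add: cutoff_commute[OF K u])
    moreover have "(\<lambda>k. cinner (proj (K k) (app N u)) (app T x)) \<longlonglongrightarrow> cinner (app N u) (app T x)"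
      by (intro tendsto_cinner lim tendsto_const)
    ultimately show "(\<lambda>k. cinner (proj (K k) u) (app T y)) \<longlonglongrightarrow> cinner (app N u) (app T x)"
      by simp
  qed
  from adjoint_eqI[OF dense this]
  show "app T x \<in> dom Ns" "app Ns (app T x) = app T (app Ns x)" by (simp_all add: y_def)
qed

end

theorem theorem3p1:
  fixes T N :: "'a::complex_hilbert op"
  assumes "closed_op T"
    and "normal_op N"
    and "dom N \<subseteq> dom T"
    and "op_le (op_comp T N) (op_comp N T)"
  shows "op_le (op_comp T (adjoint N)) (op_comp (adjoint N) T)"
proof -
  interpret intertwined N T
    using assms by unfold_locales
  \<comment> \<open>The domain of the right-hand composition also demands membership in
    \<open>dom T\<close>.\<close>
  have "dom Ns \<subseteq> dom T" using dom_adjoint_subset dom_subset by blast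
  then show ?thesis
    using fuglede_unbounded
    by (auto simp: op_le_def op_comp_def dom_def[of "(_, _)"] app_def[of "(_, _)"])
qed

end
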